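(* Let $h>1$ be an integer, $q=2^h$, and let $U$ be a nonempty subset of $\mathrm{GF}(q)^{\star}$ with $|U|<\frac{q}{4}-1$. Then no regular hyperoval $\Omega$ of $AG(2,q^2)$ is an inherited hyperoval of $\mathcal M_U(q^2)$; that is, for every regular hyperoval $\Omega$ of $AG(2,q^2)$, the point set $\Omega$ is not an arc of the projective closure $\overline{\mathcal M_U(q^2)}$ (some line of $\overline{\mathcal M_U(q^2)}$ contains at least three points of $\Omega$).
   Context: For a prime power $q$, the norm is $\|x\|=x^{q+1}$ for $x\in\mathrm{GF}(q^2)$. For a proper subset $U$ of $\mathrm{GF}(q)^{\star}$, define on $\mathrm{GF}(q^2)$ the product $a\odot b=ab$ if $\|b\|\notin U$ and $a\odot b=a^q b$ if $\|b\|\in U$. The affine plane $\mathcal M_U(q^2)$ has as points the points $P(x,y)$ of $AG(2,q^2)$, and as lines the sets $[c]=\{P(x,y): x=c\}$ and $[m,n]=\{P(x,y): y=m\odot x+n\}$ for $c,m,n\in\mathrm{GF}(q^2)$. Its projective closure $\overline{\mathcal M_U(q^2)}$ is obtained by adding one point at infinity per parallel class (lines $[m,n]$ with fixed $m$; the lines $[c]$) and the line at infinity. For $q$ even, a regular hyperoval of $PG(2,q^2)$ is the union of a non-degenerate conic and its nucleus; a regular hyperoval of $AG(2,q^2)$ is one all of whose $q^2+2$ points are affine. An arc is a set of points no three of which are collinear. *)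

theory Defs
  imports Main
begin

type_synonym 'a vec3 = "'a \<times> 'a \<times> 'a"

definition scal3 :: "'a::field \<Rightarrow> 'a vec3 \<Rightarrow> 'a vec3" where
  "scal3 k v = (case v of (x, y, z) \<Rightarrow> (k * x, k * y, k * z))"

definition add3 :: "'a::field vec3 \<Rightarrow> 'a vec3 \<Rightarrow> 'a vec3" where
  "add3 v w = (case v of (x, y, z) \<Rightarrow> case w of (x', y', z') \<Rightarrow> (x + x', y + y', z + z'))"

definition ppt :: "'a::field vec3 \<Rightarrow> 'a vec3 set" where
  "ppt v = {scal3 k v | k. k \<noteq> 0}"

definition proj_points :: "'a::field vec3 set set" where
  "proj_points = {ppt v | v. v \<noteq> (0, 0, 0)}"

definition proj_line :: "'a::field vec3 \<Rightarrow> 'a vec3 set set" where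
  "proj_line l = (case l of (a, b, c) \<Rightarrow>
     {ppt (x, y, z) | x y z. (x, y, z) \<noteq> (0, 0, 0) \<and> a * x + b * y + c * z = 0})"

definition proj_lines :: "'a::field vec3 set set set" where
  "proj_lines = {proj_line l | l. l \<noteq> (0, 0, 0)}"

definition qform :: "'a::field \<Rightarrow> 'a \<Rightarrow> 'a \<Rightarrow> 'a \<Rightarrow> 'a \<Rightarrow> 'a \<Rightarrow> 'a vec3 \<Rightarrow> 'a" where
  "qform a b c d e f v = (case v of (x, y, z) \<Rightarrow>
     a * x^2 + b * y^2 + c * z^2 + d * x * y + e * x * z + f * y * z)"

definition polar :: "('a::field vec3 \<Rightarrow> 'a) \<Rightarrow> 'a vec3 \<Rightarrow> 'a vec3 \<Rightarrow> 'a" where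
  "polar Q v w = Q (add3 v w) - Q v - Q w"

definition nondeg_qf :: "('a::field vec3 \<Rightarrow> 'a) \<Rightarrow> bool" where
  "nondeg_qf Q \<longleftrightarrow> \<not> (\<exists>v. v \<noteq> (0, 0, 0) \<and> Q v = 0 \<and> (\<forall>w. polar Q v w = 0))"

definition conic_of :: "('a::field vec3 \<Rightarrow> 'a) \<Rightarrow> 'a vec3 set set" where
  "conic_of Q = {ppt v | v. v \<noteq> (0, 0, 0) \<and> Q v = 0}"

definition nondeg_conic :: "'a::field vec3 set set \<Rightarrow> bool" where
  "nondeg_conic C \<longleftrightarrow> (\<exists>a b c d e f. nondeg_qf (qform a b c d e f) \<and> C = conic_of (qform a b c d e f))"

definition is_nucleus :: "'a::field vec3 set set \<Rightarrow> 'a vec3 set \<Rightarrow> bool" where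
  "is_nucleus C N \<longleftrightarrow> N \<in> proj_points \<and>
     (\<forall>L \<in> proj_lines. card (L \<inter> C) = 1 \<longrightarrow> N \<in> L)"

definition regular_hyperoval_PG :: "'a::field vec3 set set \<Rightarrow> bool" where
  "regular_hyperoval_PG H \<longleftrightarrow> (\<exists>C N. nondeg_conic C \<and> is_nucleus C N \<and> H = C \<union> {N})"

definition aff_pt :: "'a::field \<times> 'a \<Rightarrow> 'a vec3 set" where
  "aff_pt p = (case p of (x, y) \<Rightarrow> ppt (x, y, 1))"

definition regular_hyperoval_AG :: "('a::field \<times> 'a) set \<Rightarrow> bool" where
  "regular_hyperoval_AG \<Omega> \<longleftrightarrow> regular_hyperoval_PG (aff_pt ` \<Omega>)"

definition normq :: "nat \<Rightarrow> 'a::field \<Rightarrow> 'a" where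
  "normq q x = x ^ (q + 1)"

definition mprod :: "nat \<Rightarrow> 'a::field set \<Rightarrow> 'a \<Rightarrow> 'a \<Rightarrow> 'a" where
  "mprod q U a b = (if normq q b \<in> U then a ^ q * b else a * b)"

datatype 'a mpoint = Aff 'a 'a | InfSlope 'a | InfVert

datatype 'a mline = VertL 'a | SlopeL 'a 'a | LineInf

fun mline_points :: "nat \<Rightarrow> 'a::field set \<Rightarrow> 'a mline \<Rightarrow> 'a mpoint set" where
  "mline_points q U (VertL c) = {Aff c y | y. True} \<union> {InfVert}"
| "mline_points q U (SlopeL m n) = {Aff x y | x y. y = mprod q U m x + n} \<union> {InfSlope m}"
| "mline_points q U LineInf = range InfSlope \<union> {InfVert}"

definition is_arc_closure_M :: "nat \<Rightarrow> 'a::field set \<Rightarrow> 'a mpoint set \<Rightarrow> bool" where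
  "is_arc_closure_M q U S \<longleftrightarrow>
     (\<forall>L P1 P2 P3. P1 \<in> S \<and> P2 \<in> S \<and> P3 \<in> S \<and> P1 \<noteq> P2 \<and> P1 \<noteq> P3 \<and> P2 \<noteq> P3 \<longrightarrow>
        \<not> (P1 \<in> mline_points q U L \<and> P2 \<in> mline_points q U L \<and> P3 \<in> mline_points q U L))"

end

theory Submission
  imports Defs "HOL-Computational_Algebra.Polynomial" "HOL-Computational_Algebra.Primes"
begin

text \<open>
  In coordinates, \<open>\<Omega>\<close> is the ellipse \<open>aX\<^sup>2 + XY + bY\<^sup>2 = c\<close> with its nucleus, where
  \<open>X = x + x\<^sub>0\<close>, \<open>Y = y + y\<^sub>0\<close> and \<open>a + m + bm\<^sup>2\<close> has no root. If \<open>\<Omega>\<close> is an arc of the projective closure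
  of \<open>M\<^sub>U\<close>, then every non-vertical line of either plane meets \<open>\<Omega>\<close> in an even number of points.
  Comparing the two planes, the set \<open>A\<close> of points of \<open>\<Omega>\<close> with \<open>\<parallel>x\<parallel> \<in> U\<close> satisfies, in characteristic 2,
  \<open>\<Sum>\<^sub>A f(y + mx) = \<Sum>\<^sub>A f(y + m\<^sup>qx)\<close> for all \<open>f\<close> and \<open>m\<close>. Taking powers for \<open>f\<close>, extracting coefficients
  in \<open>m\<close>, and inverting a Vandermonde system over \<open>U\<close> (this is where \<open>|U| \<le> q/4\<close> enters), one
  finds that for each \<open>u \<in> U\<close> the function \<open>w(x)\<close>, the sum of the ordinates of the points of \<open>\<Omega>\<close> with
  abscissa \<open>x\<close>, agrees on the circle \<open>x\<^sup>q\<^sup>+\<^sup>1 = u\<close> with a polynomial of degree at most \<open>q/2 + 1\<close>. But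
  \<open>G = bw\<close> satisfies \<open>G\<^sup>2 = (x + x\<^sub>0)G\<close> for \<open>x \<noteq> x\<^sub>0\<close>, and comparing coefficients forces \<open>G = 0\<close> or
  \<open>G = x + x\<^sub>0\<close> on the whole circle: either no or every vertical line over the circle meets \<open>\<Omega>\<close>.
  An Artin-Schreier count excludes both.
\<close>

section \<open>Counting by fibres, polynomial roots and Vandermonde systems\<close>

lemma card_le_mult_fibres:
  assumes "finite A" "finite B" "f ` A \<subseteq> B"
    and "\<And>y. y \<in> B \<Longrightarrow> card {x \<in> A. f x = y} \<le> k"
  shows "card A \<le> k * card B"
proof -
  have "card A = (\<Sum>y\<in>B. card {x \<in> A. f x = y})"
    using sum.group[OF assms(1-3), of "\<lambda>_. 1::nat"] by simp
  also have "\<dots> \<le> (\<Sum>y\<in>B. k)"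
    by (intro sum_mono assms)
  finally show ?thesis by (simp add: mult.commute)
qed

lemma card_eq_mult_fibres:
  assumes "finite A" and "\<And>y. y \<in> f ` A \<Longrightarrow> card {x \<in> A. f x = y} = k"
  shows "card A = k * card (f ` A)"
proof -
  have "card A = (\<Sum>y\<in>f ` A. card {x \<in> A. f x = y})"
    using sum.group[OF assms(1), of "f ` A" f "\<lambda>_. 1::nat"] assms(1) by simp
  also have "\<dots> = (\<Sum>y\<in>f ` A. k)"
    by (intro sum.cong assms) auto
  finally show ?thesis by simp
qed

lemma coeffs_eq_0_of_many_zeros:
  fixes c :: "nat \<Rightarrow> 'a::{comm_ring_1, ring_no_zero_divisors}"
  assumes "\<And>x. x \<in> A \<Longrightarrow> (\<Sum>l\<le>n. c l * x ^ l) = 0" "n < card A" "l \<le> n"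
  shows "c l = 0"
proof -
  define p where "p = (\<Sum>l\<le>n. monom (c l) l)"
  have "degree p \<le> n"
    unfolding p_def by (intro degree_sum_le) (auto intro: order.trans[OF degree_monom_le])
  moreover have "poly p x = 0" if "x \<in> A" for x
    using assms(1)[OF that] by (simp add: p_def poly_sum poly_monom)
  ultimately have "p = 0"
    using assms(2) by (intro poly_eqI_degree[of A]) auto
  moreover have "coeff p l = c l"
    using assms(3) by (simp add: p_def coeff_sum)
  ultimately show ?thesis by simp
qed

text \<open>The product of the linear factors of all nodes other than \<open>g u\<close> has degree
  \<open>card U - 1\<close>, and the weighted sum of its values retains only the term of
  \<open>v u\<close>.\<close>

lemma vandermonde_kernel_trivial:
  fixes g v :: "'b \<Rightarrow> 'a::idom"
  assumes "finite U" "inj_on g U" "\<And>k. k < card U \<Longrightarrow> (\<Sum>u\<in>U. g u ^ k * v u) = 0"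
    and "u \<in> U"
  shows "v u = 0"
proof -
  define p where "p = (\<Prod>w\<in>U - {u}. [:- g w, 1:])"
  have "degree p \<le> sum (degree \<circ> (\<lambda>w. [:- g w, 1:])) (U - {u})"
    unfolding p_def by (rule degree_prod_sum_le) (use assms in auto)
  also have "\<dots> = card U - 1"
    using assms by simp
  finally have deg: "degree p \<le> card U - 1" .
  have cardpos: "card U > 0"
    using assms by (auto simp: card_gt_0_iff)
  have "(\<Sum>w\<in>U. poly p (g w) * v w) = (\<Sum>w\<in>U. \<Sum>k\<le>degree p. coeff p k * (g w ^ k * v w))"
    by (simp add: poly_altdef sum_distrib_right mult.assoc)
  also have "\<dots> = (\<Sum>k\<le>degree p. coeff p k * (\<Sum>w\<in>U. g w ^ k * v w))"
    by (subst sum.swap) (simp add: sum_distrib_left)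
  also have "\<dots> = 0"
    using deg cardpos by (intro sum.neutral ballI) (simp add: assms(3))
  finally have "(\<Sum>w\<in>U. poly p (g w) * v w) = 0" .
  moreover have "(\<Sum>w\<in>U. poly p (g w) * v w) = poly p (g u) * v u"
  proof -
    have "poly p (g w) = 0" if "w \<in> U - {u}" for w
      using that assms(1) by (auto simp: p_def poly_prod)
    then show ?thesis
      using assms by (subst sum.remove[of U u]) auto
  qed
  moreover have "poly p (g u) \<noteq> 0"
    using assms by (auto simp: p_def poly_prod inj_on_def)
  ultimately show ?thesis by simp
qed

subsection \<open>Arithmetic of the field\<close>

text \<open>The field enters through its size; GF(q) appears as the set of fixed points of the
  \<open>q\<close>-th power map.\<close>

locale GFq2 =
  fixes h q :: nat and F :: "'a::{field, finite} itself"
  assumes q_def: "q = 2 ^ h"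
    and card_F: "card (UNIV :: 'a set) = q ^ 2"
begin

text \<open>Translation by 1 permutes the field, so summing \<open>x + 1\<close> over it shows that
  \<open>q ^ 2\<close>, a power of 2, vanishes.\<close>

lemma two_eq_0: "(2::'a) = 0"
proof -
  have "(\<Sum>x\<in>UNIV. x + (1::'a)) = (\<Sum>x\<in>UNIV. x)"
    by (rule sum.reindex_bij_witness[of _ "\<lambda>x. x - 1" "\<lambda>x. x + 1"]) auto
  then have "of_nat (q ^ 2) = (0::'a)"
    by (simp add: sum.distrib card_F)
  then have "(2::'a) ^ (2 * h) = 0"
    by (simp add: q_def power_mult[symmetric] mult.commute)
  then show ?thesis
    using power_eq_0_iff by blast
qed

lemma add_self [simp]: "x + x = (0::'a)"
  by (simp only: mult_2[symmetric] two_eq_0 mult_zero_left)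

lemma numeral_Bit0_eq_0: "numeral (num.Bit0 k) = (0::'a)"
  by (simp only: numeral_Bit0 add_self)

lemma add_self_left [simp]: "x + (x + y) = (y::'a)"
  by (simp flip: add.assoc)

lemma minus_eq_self [simp]: "- x = (x::'a)"
  by (rule minus_unique) simp

lemma diff_eq_add [simp]: "x - y = x + (y::'a)"
  using diff_conv_add_uminus[of x y] by simp

lemma add_eq_0_iff_eq: "x + y = 0 \<longleftrightarrow> x = (y::'a)"
  using eq_neg_iff_add_eq_0[of x y] by simp

lemma add_exchange:
  assumes "x + y = z + (w::'a)"
  shows "x + z = y + w"
proof -
  have "x + z = (x + y) + (y + z)" by (simp add: add_ac)
  also have "\<dots> = y + w" unfolding assms by (simp add: add_ac)
  finally show ?thesis .
qed

lemma q_ge_2: "q \<ge> 2"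
proof -
  have "card {0, 1::'a} \<le> card (UNIV :: 'a set)"
    by (rule card_mono) auto
  then have "2 \<le> q ^ 2" by (simp add: card_F)
  then have "q \<noteq> 0" "q \<noteq> 1" by (auto intro: Nat.gr0I)
  then show ?thesis by simp
qed

lemma CHAR_2: "CHAR('a) = 2"
proof -
  have "of_nat 2 = (0::'a)"
    using two_eq_0 by simp
  then have "CHAR('a) dvd 2"
    by (subst of_nat_eq_0_iff_char_dvd[symmetric])
  then show ?thesis
    using CHAR_not_1' [where ?'a='a] by (metis One_nat_def prime_nat_iff two_is_prime_nat)
qed

lemma square_add: "(x + y) ^ 2 = x ^ 2 + (y::'a) ^ 2"
  by (simp add: power2_sum two_eq_0)

lemma square_sum: "(\<Sum>i\<in>A. f i) ^ 2 = (\<Sum>i\<in>A. (f i ::'a) ^ 2)"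
  by (rule freshmans_dream_sum) (simp_all add: CHAR_2)

lemma frob_add: "(x + y) ^ q = x ^ q + (y::'a) ^ q"
  by (rule freshmans_dream') (simp_all add: CHAR_2 q_def)

text \<open>Multiplication by \<open>x\<close> permutes the nonzero elements and so preserves their
  product.\<close>

lemma pow_card_minus_1:
  assumes "x \<noteq> (0::'a)"
  shows "x ^ (q ^ 2 - 1) = 1"
proof -
  let ?P = "\<Prod>y\<in>UNIV - {0::'a}. y"
  have "bij_betw ((*) x) (UNIV - {0}) (UNIV - {0})"
    by (rule bij_betw_byWitness[where f' = "(*) (inverse x)"]) (use assms in auto)
  then have "?P = (\<Prod>y\<in>UNIV - {0}. x * y)"
    by (rule prod.reindex_bij_betw[symmetric])
  also have "\<dots> = x ^ (q ^ 2 - 1) * ?P"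
    by (simp add: prod.distrib card_F)
  finally show ?thesis by simp
qed

lemma pow_card: "(x::'a) ^ (q ^ 2) = x"
proof (cases "x = 0")
  case False
  have "x ^ (q ^ 2) = x * x ^ (q ^ 2 - 1)"
    using q_ge_2 by (subst power_Suc[symmetric]) simp
  then show ?thesis
    by (simp only: pow_card_minus_1[OF False] mult_1_right)
qed (use q_ge_2 in auto)

lemma frob_frob [simp]: "((x::'a) ^ q) ^ q = x"
  using pow_card[of x] by (simp add: power_mult[symmetric] power2_eq_square)

text \<open>The inverse of squaring: doubling the exponent gives \<open>q ^ 2\<close>.\<close>

definition root2 :: "'a \<Rightarrow> 'a" where
  "root2 x = x ^ (q ^ 2 div 2)"

lemma even_q: "even q"
  using q_ge_2 by (cases h) (auto simp: q_def)

lemma root2_square [simp]: "root2 x ^ 2 = x"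
  using even_q by (simp add: root2_def power_mult[symmetric] pow_card)

lemma square_inject: "(x::'a) ^ 2 = y ^ 2 \<longleftrightarrow> x = y"
  by (auto simp: square_add[symmetric] add_eq_0_iff_eq[symmetric, of "_^2"] add_eq_0_iff_eq)

text \<open>An element and its partner contribute the same value twice, which is 0 in characteristic
  2.\<close>

lemma sum_eq_0_of_involution:
  fixes g :: "'b \<Rightarrow> 'a"
  assumes "finite S" "\<And>p. p \<in> S \<Longrightarrow> \<sigma> p \<in> S" "\<And>p. p \<in> S \<Longrightarrow> \<sigma> p \<noteq> p"
    "\<And>p. p \<in> S \<Longrightarrow> \<sigma> (\<sigma> p) = p" "\<And>p. p \<in> S \<Longrightarrow> g (\<sigma> p) = g p"
  shows "sum g S = 0"
  using assms
proof (induction S rule: finite_psubset_induct)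
  case (psubset S)
  show ?case
  proof (cases "S = {}")
    case False
    then obtain p where p: "p \<in> S" by auto
    let ?T = "S - {p} - {\<sigma> p}"
    have "sum g ?T = 0"
    proof (rule psubset.IH)
      show "?T \<subset> S" using p by auto
      show "\<sigma> r \<in> ?T" if "r \<in> ?T" for r
        using that psubset.prems p by (metis Diff_iff insertE insertI1 singletonD)
    qed (use psubset.prems in auto)
    moreover have "sum g S = g p + (g (\<sigma> p) + sum g ?T)"
      using p psubset.prems psubset.hyps sum.remove[of S p g] sum.remove[of "S - {p}" "\<sigma> p" g]
      by simp
    ultimately show ?thesis
      using psubset.prems p by simp
  qed auto
qed

lemma card_power_eq_le: "n > 0 \<Longrightarrow> card {x::'a. x ^ n = c} \<le> n"
proof -
  assume n: "n > 0"
  let ?p = "monom 1 n + [:c:]"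
  have "coeff ?p n = 1" using n by (simp add: coeff_pCons split: nat.splits)
  then have "?p \<noteq> 0" by (metis coeff_0 zero_neq_one)
  then have "card {x. poly ?p x = 0} \<le> degree ?p"
    by (rule card_poly_roots_bound)
  also have "degree ?p \<le> n"
    by (rule degree_add_le) (auto simp: degree_monom_le)
  finally show ?thesis
    by (simp add: poly_monom add_eq_0_iff_eq)
qed

text \<open>Substituting \<open>a * m\<close> for \<open>m\<close> multiplies the sum by
  \<open>a ^ e\<close>, and some \<open>a\<close> makes this factor differ from 1. For
  \<open>e = 0\<close> the sum consists of \<open>q ^ 2\<close> ones, because
  \<open>0 ^ 0 = 1\<close>.\<close>

lemma sum_powers_eq_0:
  assumes "\<not> (q ^ 2 - 1) dvd e \<or> e = 0"
  shows "(\<Sum>m\<in>UNIV. (m::'a) ^ e) = 0"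
proof (cases "e = 0")
  case True
  have "of_nat q = (0::'a)"
    using even_q two_eq_0 by (auto elim!: evenE)
  then show ?thesis
    using True by (simp add: card_F)
next
  case False
  define r where "r = e mod (q ^ 2 - 1)"
  have "q ^ 2 \<ge> 2 ^ 2"
    using q_ge_2 by (intro power_mono) auto
  then have r: "0 < r" "r < q ^ 2 - 1"
    using assms False by (auto simp: r_def dvd_eq_mod_eq_0)
  \<comment> \<open>Otherwise all \<open>q ^ 2 - 1\<close> nonzero elements would be roots of a
    polynomial of degree \<open>r < q ^ 2 - 1\<close>.\<close>
  have "\<exists>a::'a. a \<noteq> 0 \<and> a ^ r \<noteq> 1"
  proof (rule ccontr)
    assume "\<not> ?thesis"
    then have "card (UNIV - {0::'a}) \<le> card {x::'a. x ^ r = 1}"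
      by (intro card_mono) auto
    then show False
      using card_power_eq_le[OF r(1), of 1] r by (simp add: card_F card_Diff_subset)
  qed
  then obtain a :: 'a where a: "a \<noteq> 0" "a ^ r \<noteq> 1" by auto
  have "a ^ e = (a ^ (q ^ 2 - 1)) ^ (e div (q ^ 2 - 1)) * a ^ r"
    unfolding power_mult[symmetric] power_add[symmetric] r_def by simp
  then have "a ^ e \<noteq> 1"
    using a by (simp add: pow_card_minus_1 del: One_nat_def)
  moreover have "(\<Sum>m\<in>UNIV. (a * m) ^ e) = (\<Sum>m\<in>UNIV. m ^ e)"
    by (rule sum.reindex_bij_witness[of _ "\<lambda>m. m / a" "\<lambda>m. a * m"]) (use a in auto)
  then have "a ^ e * (\<Sum>m\<in>UNIV. m ^ e) = (\<Sum>m\<in>UNIV. m ^ e)"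
    by (simp add: power_mult_distrib sum_distrib_left)
  ultimately show ?thesis by simp
qed

lemma sum_powers_card: "(\<Sum>m\<in>UNIV. (m::'a) ^ (q ^ 2 - 1)) = 1"
proof -
  have "q ^ 2 \<ge> 2 ^ 2"
    using q_ge_2 by (intro power_mono) auto
  then have "(\<Sum>m\<in>UNIV. (m::'a) ^ (q ^ 2 - 1)) = (\<Sum>m\<in>UNIV - {0}. (m::'a) ^ (q ^ 2 - 1))"
    by (subst sum.remove[of _ 0]) (auto simp: power_0_left)
  also have "\<dots> = (\<Sum>m\<in>UNIV - {0::'a}. 1)"
    by (intro sum.cong) (auto simp: pow_card_minus_1 simp del: One_nat_def)
  also have "\<dots> = of_nat (q ^ 2 - 1)"
    by (simp add: card_F card_Diff_subset)
  also have "\<dots> = 1"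
  proof -
    have "odd (q ^ 2 - 1)"
      using even_q q_ge_2 by simp
    then obtain k where "q ^ 2 - 1 = 2 * k + 1" by (rule oddE)
    then show ?thesis using two_eq_0 by simp
  qed
  finally show ?thesis .
qed

text \<open>A fibre of the norm.\<close>

definition circle :: "'a \<Rightarrow> 'a set" where
  "circle u = {x. x ^ (q + 1) = u}"

text \<open>The \<open>q ^ 2 - 1\<close> nonzero elements are distributed over at most
  \<open>q - 1\<close> norm values, with at most \<open>q + 1\<close> of them in each fibre; hence
  no fibre can be smaller.\<close>

lemma card_circle:
  assumes "u \<noteq> 0" "u ^ q = u"
  shows "card (circle u) = q + 1"
proof (rule ccontr)
  assume "card (circle u) \<noteq> q + 1"
  have le: "card (circle v) \<le> q + 1" for v
    unfolding circle_def by (rule card_power_eq_le) simp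
  let ?V = "{v::'a. v ^ (q - 1) = 1}"
  have u: "u \<in> ?V"
    using assms q_ge_2 power_Suc[of u "q - 1"] by simp
  have "q ^ 2 - 1 = card (UNIV - {0::'a})"
    by (simp add: card_F card_Diff_subset)
  also have "\<dots> = (\<Sum>v\<in>?V. card {x \<in> UNIV - {0}. x ^ (q + 1) = v})"
  proof -
    have "(x ^ (q + 1)) ^ (q - 1) = 1" if "x \<noteq> 0" for x :: 'a
    proof -
      have "(q + 1) * (q - 1) = q ^ 2 - 1"
        using q_ge_2 by (simp add: power2_eq_square algebra_simps diff_mult_distrib2)
      then show ?thesis
        using pow_card_minus_1[OF that] by (simp only: power_mult[symmetric])
    qed
    then have "(\<lambda>x. x ^ (q + 1)) ` (UNIV - {0::'a}) \<subseteq> ?V"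
      by blast
    from sum.group[OF _ _ this, of "\<lambda>_. 1::nat"] show ?thesis
      by simp
  qed
  also have "\<dots> \<le> (\<Sum>v\<in>?V. card (circle v))"
    by (intro sum_mono card_mono) (auto simp: circle_def)
  also have "\<dots> < (\<Sum>v\<in>?V. q + 1)"
    using le u \<open>card (circle u) \<noteq> q + 1\<close>
    by (intro sum_strict_mono_ex1) (auto intro!: bexI[of _ u] simp: order.strict_iff_order)
  also have "\<dots> \<le> (q + 1) * (q - 1)"
    using card_power_eq_le[of "q - 1" 1] q_ge_2
    by (simp del: One_nat_def mult_Suc mult_Suc_right add: mult.commute)
  also have "\<dots> = q ^ 2 - 1"
    using q_ge_2 by (simp add: power2_eq_square algebra_simps diff_mult_distrib2)
  finally show False by simp
qed

end

subsection \<open>Intersection with lines of both planes\<close>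

text \<open>\<open>b_nz\<close> and \<open>no_root\<close> say that the conic has no point at
  infinity (vertical, or of slope \<open>m\<close>); \<open>c_nz\<close> says that the nucleus
  \<open>(x0, y0)\<close> is not on it. The mixed coefficient is scaled to 1.\<close>

locale ellipse = GFq2 h q F for h q and F :: "'a::{field, finite} itself" +
  fixes a b c x0 y0 :: 'a
  assumes b_nz: "b \<noteq> 0" and c_nz: "c \<noteq> 0"
    and no_root: "\<And>m. a + m + b * m ^ 2 \<noteq> 0"
begin

definition hyperoval :: "('a \<times> 'a) set" where
  "hyperoval = {(x, y). a * (x + x0) ^ 2 + (x + x0) * (y + y0) + b * (y + y0) ^ 2 = c \<or>
     (x = x0 \<and> y = y0)}"

text \<open>A line of slope \<open>m\<close> through a point \<open>(x, y)\<close> of the hyperoval meets it again at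
  \<open>(x + \<delta>, y + m \<delta>)\<close> with \<open>\<delta> = shift m x y\<close>; the case \<open>k = 0\<close> is that of lines through the nucleus.\<close>
definition shift :: "'a \<Rightarrow> 'a \<Rightarrow> 'a \<Rightarrow> 'a" where
  "shift m x y = (let D = a + m + b * m ^ 2; k = (y + y0) + m * (x + x0) in
     if k = 0 then root2 (c / D) else k / D)"

lemma shift_nz: "shift m x y \<noteq> 0"
proof -
  have "root2 (c / (a + m + b * m ^ 2)) \<noteq> 0"
    using root2_square[of "c / (a + m + b * m ^ 2)"] c_nz no_root[of m] by fastforce
  then show ?thesis
    using no_root[of m] by (simp add: shift_def Let_def)
qed

text \<open>\<open>shift\<close> sees the point only through \<open>k\<close>, which is constant
  along the line; so moving by it is an involution.\<close>

lemma shift_shift: "shift m (x + d) (y + m * d) = shift m x y"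
proof -
  have "(y + m * d + y0) + m * (x + d + x0) = (y + y0) + m * (x + x0)"
    by (simp add: ring_distribs add_ac)
  then show ?thesis by (simp only: shift_def)
qed

text \<open>With \<open>Y = k + m * X\<close> the equation becomes
  \<open>D * X ^ 2 + k * X + b * k ^ 2 = c\<close>, whose roots differ by \<open>k / D\<close>. If
  \<open>k = 0\<close>, the only root is \<open>X = r\<close>, and the second point is the nucleus,
  \<open>X = 0\<close>.\<close>

lemma shift_in_hyperoval:
  assumes "(x, y) \<in> hyperoval"
  shows "(x + shift m x y, y + m * shift m x y) \<in> hyperoval"
proof -
  define D where "D = a + m + b * m ^ 2"
  define k where "k = (y + y0) + m * (x + x0)"
  define r where "r = root2 (c / D)"
  have D: "D \<noteq> 0" using no_root by (simp add: D_def)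
  have r: "D * r ^ 2 = c" using D by (simp add: r_def)
  have on: "(x + d, y + m * d) \<in> hyperoval \<longleftrightarrow>
      D * (x + x0 + d) ^ 2 + k * (x + x0 + d) + b * k ^ 2 = c \<or> (k = 0 \<and> x + x0 + d = 0)" for d
  proof -
    have "a * (x + d + x0) ^ 2 + (x + d + x0) * (y + m * d + y0) + b * (y + m * d + y0) ^ 2 =
        D * (x + x0 + d) ^ 2 + k * (x + x0 + d) + b * k ^ 2"
      unfolding D_def k_def by (simp add: ring_distribs add_ac mult_ac power2_eq_square)
    moreover have "x + d = x0 \<and> y + m * d = y0 \<longleftrightarrow> k = 0 \<and> x + x0 + d = 0"
    proof -
      have "y + m * d + y0 = k + m * (x + x0 + d)"
        by (simp add: k_def ring_distribs add_ac)
      moreover have "x + d + x0 = x + x0 + d" by (simp add: add_ac)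
      ultimately show ?thesis
        unfolding add_eq_0_iff_eq[symmetric, of "x + d"] add_eq_0_iff_eq[symmetric, of "y + m * d"]
        by (metis add_0_right mult_zero_right)
    qed
    ultimately show ?thesis
      by (simp add: hyperoval_def)
  qed
  show ?thesis
  proof (cases "k = 0")
    case True
    then have sh: "shift m x y = r"
      by (simp add: shift_def Let_def k_def r_def D_def)
    from assms on[of 0] True consider "D * (x + x0) ^ 2 = c" | "x + x0 = 0" by auto
    then show ?thesis
    proof cases
      case 1
      then have "(x + x0) ^ 2 = r ^ 2"
        using r D by (metis mult_left_cancel)
      then have "x + x0 = r" by (simp add: square_inject)
      then show ?thesis
        unfolding sh on using True by simp
    next
      case 2
      then show ?thesis
        unfolding sh on using True r by simp
    qed
  next
    case False
    then have sh: "shift m x y = k / D"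
      by (simp add: shift_def Let_def k_def D_def)
    have "D * (x + x0) ^ 2 + k * (x + x0) + b * k ^ 2 = c"
      using assms on[of 0] False by simp
    moreover have "D * (x + x0 + k / D) ^ 2 + k * (x + x0 + k / D) =
        D * (x + x0) ^ 2 + k * (x + x0)"
      using D by (simp add: square_add power_divide power2_eq_square[of k] power2_eq_square[of D]
        distrib_left add_ac)
    ultimately show ?thesis
      unfolding sh on by simp
  qed
qed

lemma sum_lines_AG: "(\<Sum>(x, y)\<in>hyperoval. f (y + m * x)) = (0::'a)"
proof (rule sum_eq_0_of_involution)
  let ?\<sigma> = "\<lambda>(x, y). (x + shift m x y, y + m * shift m x y)"
  show "?\<sigma> p \<in> hyperoval" if "p \<in> hyperoval" for p
    using that shift_in_hyperoval by (auto split: prod.splits)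
  show "?\<sigma> p \<noteq> p" for p
    using shift_nz by (auto split: prod.splits)
  show "?\<sigma> (?\<sigma> p) = p" for p
    by (auto split: prod.splits simp: shift_shift add.assoc)
  show "(case ?\<sigma> p of (x, y) \<Rightarrow> f (y + m * x)) = (case p of (x, y) \<Rightarrow> f (y + m * x))" for p
    by (auto split: prod.splits simp: distrib_left add_ac)
qed simp

end

section \<open>Lines of the plane with the twisted product\<close>

context GFq2
begin

lemma mprod_add: "mprod q U (m + m') x = mprod q U m x + mprod q U m' (x::'a)"
  by (simp add: mprod_def frob_add distrib_right)

text \<open>Two points with different abscissas are joined by a line. The map \<open>?f\<close> is
  additive in \<open>m\<close>, so injectivity follows from a trivial kernel: across the two
  branches of \<open>mprod\<close>, a nonzero kernel element would force \<open>x\<close> and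
  \<open>x'\<close> to have equal norms.\<close>

lemma mslope_exists:
  assumes "x \<noteq> (x'::'a)"
  shows "\<exists>m. y + mprod q U m x = y' + mprod q U m x'"
proof -
  let ?f = "\<lambda>m. mprod q U m x + mprod q U m x'"
  have ker: "m = 0" if "mprod q U m x = mprod q U m x'" for m
  proof (rule ccontr)
    assume m: "m \<noteq> 0"
    have norm: "m ^ q * s \<noteq> m * t" if "normq q s \<noteq> normq q t" for s t
    proof
      assume "m ^ q * s = m * t"
      then have "(m ^ q * s) * (m ^ q * s) ^ q = (m * t) * (m * t) ^ q" by simp
      then have "(m * m ^ q) * normq q s = (m * m ^ q) * normq q t"
        by (simp add: power_mult_distrib normq_def mult_ac)
      then show False using m that by simp
    qed
    show False
      using norm[of x x'] norm[of x' x] that assms m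
      by (cases "normq q x = normq q x'") (auto simp: mprod_def split: if_splits)
  qed
  have "inj ?f"
  proof
    fix m m' assume "?f m = ?f m'"
    then have "mprod q U (m + m') x = mprod q U (m + m') x'"
      unfolding mprod_add by (rule add_exchange)
    then show "m = m'"
      using ker add_eq_0_iff_eq by blast
  qed
  then have "surj ?f" by (simp add: finite_UNIV_inj_surj)
  then obtain m where "y + y' = ?f m" by (rule surjE)
  then have "y + mprod q U m x = y' + mprod q U m x'"
    by (rule add_exchange)
  then show ?thesis ..
qed

end

context ellipse
begin

context
  fixes U :: "'a set"
  assumes arc: "is_arc_closure_M q U ((\<lambda>(x, y). Aff x y) ` hyperoval)"
begin

lemma no_three_on_mline:
  assumes "(x1, y1) \<in> hyperoval" "(x2, y2) \<in> hyperoval" "(x3, y3) \<in> hyperoval"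
    and "(x1, y1) \<noteq> (x2, y2)" "(x1, y1) \<noteq> (x3, y3)" "(x2, y2) \<noteq> (x3, y3)"
    and "y1 + mprod q U m x1 = n" "y2 + mprod q U m x2 = n" "y3 + mprod q U m x3 = n"
  shows False
proof -
  have "y = mprod q U m x + n" if "y + mprod q U m x = n" for x y
    using that by (auto simp: add_ac)
  with assms(7-9) have "Aff x1 y1 \<in> mline_points q U (SlopeL m n)"
    "Aff x2 y2 \<in> mline_points q U (SlopeL m n)" "Aff x3 y3 \<in> mline_points q U (SlopeL m n)"
    by auto
  moreover have "Aff x1 y1 \<in> (\<lambda>(x, y). Aff x y) ` hyperoval"
    "Aff x2 y2 \<in> (\<lambda>(x, y). Aff x y) ` hyperoval" "Aff x3 y3 \<in> (\<lambda>(x, y). Aff x y) ` hyperoval"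
    using assms(1-3) by force+
  moreover have "Aff x1 y1 \<noteq> Aff x2 y2" "Aff x1 y1 \<noteq> Aff x3 y3" "Aff x2 y2 \<noteq> Aff x3 y3"
    using assms(4-6) by auto
  ultimately show False
    using arc unfolding is_arc_closure_M_def by blast
qed

text \<open>Each slope \<open>t\<close> of AG leads to another point of the hyperoval, and
  \<open>\<mu> t\<close> is the slope of the twisted line joining it to \<open>(x, y)\<close>. The
  arc property makes \<open>\<mu>\<close> injective, hence surjective, so every twisted slope
  occurs.\<close>

lemma second_point_on_mline:
  assumes p: "(x, y) \<in> hyperoval"
  shows "\<exists>x' y'. (x', y') \<in> hyperoval \<and> (x', y') \<noteq> (x, y) \<and>
    y' + mprod q U m x' = y + mprod q U m x"
proof -
  let ?X = "\<lambda>t. x + shift t x y" and ?Y = "\<lambda>t. y + t * shift t x y"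
  have "\<exists>\<mu>. \<forall>t. y + mprod q U (\<mu> t) x = ?Y t + mprod q U (\<mu> t) (?X t)"
    by (rule choice, rule allI, rule mslope_exists) (simp add: shift_nz)
  then obtain \<mu> where \<mu>: "\<And>t. y + mprod q U (\<mu> t) x = ?Y t + mprod q U (\<mu> t) (?X t)"
    by blast
  have "inj \<mu>"
  proof (rule injI, rule ccontr)
    fix s t assume st: "\<mu> s = \<mu> t" "s \<noteq> t"
    have "(?X s, ?Y s) \<noteq> (?X t, ?Y t)"
      using st(2) shift_nz[of s x y] by auto
    moreover have "?X s \<noteq> x" "?X t \<noteq> x"
      using shift_nz by auto
    ultimately show False
      using no_three_on_mline[of x y "?X s" "?Y s" "?X t" "?Y t" "\<mu> s" "y + mprod q U (\<mu> s) x"]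
        p shift_in_hyperoval[OF p] \<mu>[of s] \<mu>[of t] st(1) by auto
  qed
  then have "surj \<mu>" by (simp add: finite_UNIV_inj_surj)
  then obtain t where "m = \<mu> t" by (metis surjE)
  then show ?thesis
    using \<mu>[of t] shift_in_hyperoval[OF p] shift_nz[of t x y]
    by (intro exI[of _ "?X t"] exI[of _ "?Y t"]) auto
qed

lemma sum_mlines: "(\<Sum>(x, y)\<in>hyperoval. f (y + mprod q U m x)) = (0::'a)"
proof -
  let ?v = "\<lambda>(x, y). y + mprod q U m x"
  have "\<forall>p\<in>hyperoval. \<exists>r. r \<in> hyperoval \<and> r \<noteq> p \<and> ?v r = ?v p"
    using second_point_on_mline by (auto split: prod.splits)
  then obtain \<sigma> where \<sigma>: "\<And>p. p \<in> hyperoval \<Longrightarrow> \<sigma> p \<in> hyperoval \<and> \<sigma> p \<noteq> p \<and> ?v (\<sigma> p) = ?v p"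
    by metis
  have "(\<Sum>p\<in>hyperoval. f (?v p)) = 0"
  proof (rule sum_eq_0_of_involution)
    \<comment> \<open>Otherwise \<open>p\<close>, \<open>\<sigma> p\<close> and
      \<open>\<sigma> (\<sigma> p)\<close> would be three points of the arc on one line.\<close>
    show "\<sigma> (\<sigma> p) = p" if p: "p \<in> hyperoval" for p
    proof (rule ccontr)
      assume "\<sigma> (\<sigma> p) \<noteq> p"
      with \<sigma>[OF p] \<sigma>[of "\<sigma> p"] p show False
        using no_three_on_mline[of "fst p" "snd p" "fst (\<sigma> p)" "snd (\<sigma> p)"
          "fst (\<sigma> (\<sigma> p))" "snd (\<sigma> (\<sigma> p))" m "?v p"]
        by (auto simp: case_prod_unfold)
    qed
  qed (use \<sigma> in auto)
  then show ?thesis by (simp add: case_prod_unfold)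
qed

text \<open>Points whose norm is outside \<open>U\<close> contribute equally to the two vanishing
  sums, and cancel.\<close>

lemma sum_affected_conj:
  "(\<Sum>(x, y) | (x, y) \<in> hyperoval \<and> x ^ (q + 1) \<in> U. f (y + m * x)) =
   (\<Sum>(x, y) | (x, y) \<in> hyperoval \<and> x ^ (q + 1) \<in> U. f (y + m ^ q * x) :: 'a)"
proof -
  let ?A = "{(x, y). (x, y) \<in> hyperoval \<and> x ^ (q + 1) \<in> U}"
  let ?B = "hyperoval - ?A"
  have split: "sum g hyperoval = sum g ?B + sum g ?A" for g :: "'a \<times> 'a \<Rightarrow> 'a"
    by (rule sum.subset_diff) auto
  have "(\<Sum>(x, y)\<in>?B. f (y + mprod q U m x)) = (\<Sum>(x, y)\<in>?B. f (y + m * x))"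
    by (intro sum.cong refl) (simp add: case_prod_unfold mprod_def normq_def)
  moreover have "(\<Sum>(x, y)\<in>?A. f (y + mprod q U m x)) = (\<Sum>(x, y)\<in>?A. f (y + m ^ q * x))"
    by (intro sum.cong) (auto simp: mprod_def normq_def)
  ultimately show ?thesis
    using sum_lines_AG[of f m] sum_mlines[of f m] unfolding split
    by (metis (no_types, lifting) add_eq_0_iff_eq)
qed

end

end

subsection \<open>Moments\<close>

text \<open>Multiplication by \<open>q\<close> modulo \<open>q\<^sup>2 - 1\<close> swaps the two base-\<open>q\<close> digits of the exponent.\<close>
lemma digit_swap_too_large:
  fixes q i0 i1 r :: nat
  assumes "i1 < i0" "i0 < q" "2 < q" "r \<le> i0 + q * i1 + 1"
  shows "\<not> (q ^ 2 - 1) dvd (q ^ 2 - 1 - (i0 + q * i1) + q * r)"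
proof
  assume "(q ^ 2 - 1) dvd (q ^ 2 - 1 - (i0 + q * i1) + q * r)"
  then obtain k where k: "q ^ 2 - 1 - (i0 + q * i1) + q * r = (q ^ 2 - 1) * k" ..
  have "q * i1 \<le> q * (q - 2)"
    using assms by (intro mult_left_mono) auto
  also have "\<dots> = q ^ 2 - 2 * q"
    by (simp add: power2_eq_square diff_mult_distrib2)
  finally have "q * i1 \<le> q ^ 2 - 2 * q" .
  moreover have "2 * q \<le> q ^ 2"
    using assms by (simp add: power2_eq_square)
  ultimately have small: "i0 + q * i1 < q ^ 2 - 1"
    using assms by linarith
  have "k \<noteq> 0"
    using k small by (auto intro: Nat.gr0I)
  then obtain t where t: "k = Suc t" by (cases k) auto
  \<comment> \<open>Adding \<open>t + (i0 + q * i1)\<close> clears the subtraction; the resulting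
    equation determines \<open>t\<close> modulo \<open>q\<close>.\<close>
  have "q * r + t + (q ^ 2 - 1) = (q ^ 2 - 1 - (i0 + q * i1) + q * r) + t + (i0 + q * i1)"
    using small by simp
  also have "\<dots> = (q ^ 2 - 1) + ((q ^ 2 - 1) * t + t) + (i0 + q * i1)"
    unfolding k t by simp
  also have "(q ^ 2 - 1) * t + t = q ^ 2 * t"
    using assms by (simp add: diff_mult_distrib)
  finally have eq: "q * r + t = q * (q * t + i1) + i0"
    by (simp add: power2_eq_square algebra_simps)
  have "t mod q = i0"
  proof -
    have "t mod q = (q * r + t) mod q" by simp
    also have "\<dots> = i0" unfolding eq using assms by simp
    finally show ?thesis .
  qed
  then obtain s where s: "t = q * s + i0"
    by (metis mult_div_mod_eq)
  have "q * (r + s) = q * (q * t + i1)"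
    using eq s by (simp add: algebra_simps)
  then have "r + s = q * t + i1"
    using assms by simp
  \<comment> \<open>So \<open>r\<close> is at least the number with swapped digits, which exceeds
    \<open>i0 + q * i1\<close> by \<open>(q - 1) * (i0 - i1)\<close>, at least 2.\<close>
  then have "r + s = q * i0 + i1 + q * (q * s)"
    using s by (simp add: algebra_simps)
  moreover have "s \<le> q * (q * s)"
    using mult_mono[of 1 q "1 * s" "q * s"] assms by simp
  ultimately have "q * i0 + i1 \<le> r"
    by linarith
  then have le: "q * i0 + i1 \<le> i0 + q * i1 + 1"
    using assms by simp
  obtain d where d: "i0 = i1 + d" "d > 0"
    using assms less_imp_add_positive by blast
  have "3 * d \<le> q * d"
    using assms by (intro mult_right_mono) auto
  moreover have "q * d \<le> d + 1"
    using le d by (simp add: algebra_simps)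
  ultimately show False
    using d by linarith
qed

context GFq2
begin

lemma sum_shifted_power:
  fixes x y :: 'a
  shows "(\<Sum>m\<in>UNIV. m ^ M * (y + m ^ e * x) ^ N) =
    (\<Sum>r\<le>N. of_nat (N choose r) * x ^ r * y ^ (N - r) * (\<Sum>m\<in>UNIV. m ^ (M + e * r)))"
proof -
  have "m ^ M * (y + m ^ e * x) ^ N =
      (\<Sum>r\<le>N. of_nat (N choose r) * x ^ r * y ^ (N - r) * m ^ (M + e * r))" for m
    unfolding add.commute[of y] binomial_ring sum_distrib_left
    by (intro sum.cong) (simp_all add: power_mult_distrib power_add mult_ac flip: power_mult)
  then show ?thesis
    by (simp add: sum.swap[of _ _ UNIV] sum_distrib_left)
qed

text \<open>Take \<open>f\<close> to be the power \<open>i + 1\<close> and sum over \<open>m\<close>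
  with weight \<open>m ^ M\<close>. On the left only the binomial term \<open>r = i\<close>
  survives, with coefficient \<open>i + 1\<close>, which is 1 because \<open>i\<close> is even; on
  the right \<open>digit_swap_too_large\<close> kills every term.\<close>

lemma moment_eq_0:
  fixes A :: "('a \<times> 'a) set"
  assumes conj: "\<And>(f :: 'a \<Rightarrow> 'a) m.
      (\<Sum>(x, y)\<in>A. f (y + m * x)) = (\<Sum>(x, y)\<in>A. f (y + m ^ q * x))"
    and i: "even i0" "i1 < i0" "i0 < q"
  shows "(\<Sum>(x, y)\<in>A. x ^ (i0 + q * i1) * y) = 0"
proof -
  define i where "i = i0 + q * i1"
  define M where "M = q ^ 2 - 1 - i"
  have q: "2 < q"
    using i by (cases "q = 2") auto
  have "q * i1 \<le> q * (q - 2)"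
    using i by (intro mult_left_mono) auto
  also have "\<dots> = q ^ 2 - 2 * q"
    by (simp add: power2_eq_square diff_mult_distrib2)
  finally have "q * i1 \<le> q ^ 2 - 2 * q" .
  moreover have "2 * q \<le> q ^ 2"
    using q by (simp add: power2_eq_square)
  ultimately have small: "i + q < q ^ 2"
    unfolding i_def using i by linarith
  have line: "(\<Sum>m\<in>UNIV. m ^ M * (y + m ^ 1 * x) ^ (i + 1)) = x ^ i * y" for x y :: 'a
  proof -
    have "(\<Sum>m\<in>UNIV. (m::'a) ^ (M + 1 * r)) = (if r = i then 1 else 0)" if "r \<le> i + 1" for r
    proof (cases "r = i")
      case True
      then show ?thesis
        using small q sum_powers_card by (simp add: M_def)
    next
      case False
      \<comment> \<open>The exponent lies between 1 and \<open>q ^ 2\<close>, so the only multiple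
        it can equal is \<open>q ^ 2 - 1\<close>, attained at \<open>r = i\<close>.\<close>
      have "\<not> (q ^ 2 - 1) dvd (M + r)"
      proof
        assume "(q ^ 2 - 1) dvd (M + r)"
        then obtain k where k: "M + r = (q ^ 2 - 1) * k" ..
        consider "k = 0" | "k = 1" | "k \<ge> 2" by linarith
        then show False
        proof cases
          case 3
          then have "(q ^ 2 - 1) * 2 \<le> M + r"
            unfolding k by (intro mult_left_mono) auto
          then show False
            using that small q by (simp add: M_def)
        qed (use k small q False in \<open>auto simp: M_def\<close>)
      qed
      then show ?thesis
        using False by (simp add: sum_powers_eq_0)
    qed
    then have "(\<Sum>m\<in>UNIV. m ^ M * (y + m ^ 1 * x) ^ (i + 1)) =
        (\<Sum>r\<le>i + 1. if r = i then of_nat (i + 1 choose r) * x ^ r * y ^ (i + 1 - r) else 0)"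
      unfolding sum_shifted_power by (intro sum.cong) auto
    also have "\<dots> = of_nat (i + 1) * x ^ i * y"
      by simp
    also have "of_nat (i + 1) = (1::'a)"
    proof -
      have "even i" using i even_q by (simp add: i_def)
      then show ?thesis using two_eq_0 by (auto elim!: evenE)
    qed
    finally show ?thesis by simp
  qed
  have conj_line: "(\<Sum>m\<in>UNIV. m ^ M * (y + m ^ q * x) ^ (i + 1)) = 0" for x y :: 'a
    unfolding sum_shifted_power
  proof (intro sum.neutral ballI)
    fix r assume "r \<in> {..i + 1}"
    then have "\<not> (q ^ 2 - 1) dvd (M + q * r)"
      using digit_swap_too_large[of i1 i0 q r] i q by (simp add: M_def i_def)
    then show "of_nat (i + 1 choose r) * x ^ r * y ^ (i + 1 - r) * (\<Sum>m\<in>UNIV. m ^ (M + q * r)) = 0"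
      by (simp add: sum_powers_eq_0)
  qed
  have swap: "(\<Sum>(x, y)\<in>A. \<Sum>m\<in>UNIV. m ^ M * (y + g m * x) ^ (i + 1)) =
      (\<Sum>m\<in>UNIV. m ^ M * (\<Sum>(x, y)\<in>A. (y + g m * x) ^ (i + 1)))" for g :: "'a \<Rightarrow> 'a"
    unfolding case_prod_unfold by (subst sum.swap) (simp add: sum_distrib_left)
  have "(\<Sum>(x, y)\<in>A. x ^ i * y) = (\<Sum>(x, y)\<in>A. \<Sum>m\<in>UNIV. m ^ M * (y + m * x) ^ (i + 1))"
    using line by (simp add: power_one_right)
  also have "\<dots> = (\<Sum>(x, y)\<in>A. \<Sum>m\<in>UNIV. m ^ M * (y + m ^ q * x) ^ (i + 1))"
    unfolding swap by (intro sum.cong refl arg_cong2[of _ _ _ _ "(*)"] conj)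
  also have "\<dots> = 0"
    unfolding conj_line by simp
  finally show ?thesis
    unfolding i_def .
qed

text \<open>On the circle of \<open>u\<close>,
  \<open>x ^ ((j + i1) + q * i1) = u ^ i1 * x ^ j\<close>. So the vanishing moments over
  \<open>A\<close> form a linear system for the moments over the single circles.\<close>

lemma circle_moment_eq_0:
  fixes A :: "('a \<times> 'a) set" and U :: "'a set"
  assumes conj: "\<And>(f :: 'a \<Rightarrow> 'a) m.
      (\<Sum>(x, y)\<in>A. f (y + m * x)) = (\<Sum>(x, y)\<in>A. f (y + m ^ q * x))"
    and A: "\<And>x y. (x, y) \<in> A \<Longrightarrow> x ^ (q + 1) \<in> U" and U: "4 * card U \<le> q"
    and j: "0 < j" "2 * j < q" and u: "u \<in> U" "u \<noteq> 0"
  shows "(\<Sum>(x, y) | (x, y) \<in> A \<and> x ^ (q + 1) = u. x ^ j * y) = 0"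
proof -
  let ?s = "\<lambda>u. \<Sum>(x, y) | (x, y) \<in> A \<and> x ^ (q + 1) = u. x ^ j * y"
  have "u ^ (j mod 2) * ?s u = 0"
  proof (rule vandermonde_kernel_trivial[of U "\<lambda>u. u ^ 2" "\<lambda>u. u ^ (j mod 2) * ?s u"])
    show "inj_on (\<lambda>u. u\<^sup>2) U"
      by (auto simp: inj_on_def square_inject)
    fix k assume k: "k < card U"
    \<comment> \<open>The parity makes the low digit \<open>j + i1\<close> even, and the steps of 2
      give a Vandermonde system in the nodes \<open>u ^ 2\<close>.\<close>
    define i1 where "i1 = j mod 2 + 2 * k"
    have "even (j + i1)" by (auto simp: i1_def)
    moreover have "j + i1 < q"
    proof -
      have "j mod 2 \<le> 1" by simp
      moreover have "2 * q \<ge> 4 * j + 4"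
        using j even_q by presburger
      moreover have "2 * q \<ge> 8 * k + 8"
        using U k by simp
      ultimately show ?thesis
        unfolding i1_def by linarith
    qed
    ultimately have 0: "(\<Sum>(x, y)\<in>A. x ^ ((j + i1) + q * i1) * y) = 0"
      using j by (intro moment_eq_0[OF conj]) auto
    have "(\<Sum>u\<in>U. (u ^ 2) ^ k * (u ^ (j mod 2) * ?s u)) =
        (\<Sum>u\<in>U. \<Sum>(x, y) | (x, y) \<in> A \<and> x ^ (q + 1) = u. x ^ ((j + i1) + q * i1) * y)"
    proof (intro sum.cong refl)
      fix u
      have "(u ^ 2) ^ k * (u ^ (j mod 2) * ?s u) = u ^ i1 * ?s u"
        by (simp add: i1_def power_add mult_ac flip: power_mult)
      also have "\<dots> = (\<Sum>(x, y) | (x, y) \<in> A \<and> x ^ (q + 1) = u. u ^ i1 * (x ^ j * y))"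
        by (simp add: sum_distrib_left case_prod_unfold)
      also have "\<dots> = (\<Sum>(x, y) | (x, y) \<in> A \<and> x ^ (q + 1) = u. x ^ ((j + i1) + q * i1) * y)"
      proof (intro sum.cong refl, clarify)
        fix x y assume "u = x ^ (q + 1)"
        have "(x ^ (q + 1)) ^ i1 * x ^ j = x ^ ((j + i1) + q * i1)"
          unfolding power_mult[symmetric] power_add[symmetric] by (simp add: algebra_simps)
        then show "(x ^ (q + 1)) ^ i1 * (x ^ j * y) = x ^ ((j + i1) + q * i1) * y"
          by (simp only: mult.assoc[symmetric])
      qed
      finally show "(u ^ 2) ^ k * (u ^ (j mod 2) * ?s u) = \<dots>" .
    qed
    also have "\<dots> = (\<Sum>(x, y)\<in>A. x ^ ((j + i1) + q * i1) * y)"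
    proof -
      have "(\<lambda>(x, y). x ^ (q + 1)) ` A \<subseteq> U" using A by auto
      from sum.group[OF _ _ this, of "\<lambda>(x, y). x ^ ((j + i1) + q * i1) * y"] show ?thesis
        by (simp add: case_prod_unfold Collect_case_prod_Sigma)
    qed
    finally show "(\<Sum>u\<in>U. (u ^ 2) ^ k * (u ^ (j mod 2) * ?s u)) = 0"
      using 0 by simp
  qed (use u in auto)
  then show ?thesis using u by simp
qed

subsection \<open>Rigidity on circles\<close>

text \<open>\<open>x * inverse t\<close> is a root of unity of order dividing \<open>q + 1\<close>,
  and \<open>q + 1\<close> is 1 in the field.\<close>

lemma geometric_circle:
  assumes "x \<in> circle u" "t \<in> circle u" "u \<noteq> 0"
  shows "(\<Sum>l\<le>q. (x * inverse t) ^ l) = (if x = t then 1 else 0)"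
proof -
  have t: "t \<noteq> 0" using assms by (auto simp: circle_def)
  show ?thesis
  proof (cases "x = t")
    case True
    obtain p where "q = 2 * p" using even_q by (rule evenE)
    then show ?thesis using True t two_eq_0 by simp
  next
    case False
    have "(x * inverse t) ^ Suc q = 1"
      using assms t by (simp add: circle_def power_mult_distrib power_inverse del: power_Suc)
    moreover have "x * inverse t \<noteq> 1"
      using False t by (simp add: field_simps)
    ultimately show ?thesis
      using False geometric_sum[of "x * inverse t" "Suc q"]
      by (simp add: lessThan_Suc_atMost del: power_Suc sum.lessThan_Suc)
  qed
qed

text \<open>On a circle the moments of \<open>G\<close> are the coefficients of its interpolation polynomial,
  in reverse order; hence vanishing moments bound the degree.\<close>
lemma circle_interpolation:
  fixes G :: "'a \<Rightarrow> 'a"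
  assumes u: "u \<noteq> 0"
    and mom: "\<And>j. 0 < j \<Longrightarrow> 2 * j < q \<Longrightarrow> (\<Sum>t\<in>circle u. t ^ j * G t) = 0"
  obtains g where "\<And>l. q + 2 < 2 * l \<Longrightarrow> g l = 0"
    and "\<And>x. x \<in> circle u \<Longrightarrow> G x = (\<Sum>l\<le>q. g l * x ^ l)"
proof
  \<comment> \<open>Discrete Fourier coefficients; the value 0 beyond \<open>q\<close> lets the
    vanishing hold for all large \<open>l\<close>.\<close>
  define g where "g l = (if l \<le> q then \<Sum>t\<in>circle u. G t * inverse t ^ l else 0)" for l
  show "g l = 0" if "q + 2 < 2 * l" for l
  proof (cases "l \<le> q")
    case True
    define j where "j = q + 1 - l"
    have *: "inverse t ^ l * G t = inverse u * (t ^ j * G t)" if "t \<in> circle u" for t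
    proof -
      have t: "t \<noteq> 0" using that u by (auto simp: circle_def)
      have "t ^ j * t ^ l = u"
        using True that by (simp add: j_def circle_def flip: power_add)
      then show ?thesis
        using t u by (auto simp: field_simps)
    qed
    have "g l = (\<Sum>t\<in>circle u. inverse t ^ l * G t)"
      using True by (simp add: g_def mult.commute)
    also have "\<dots> = inverse u * (\<Sum>t\<in>circle u. t ^ j * G t)"
      unfolding sum_distrib_left by (intro sum.cong refl *)
    also have "\<dots> = 0"
      using True that by (subst mom) (auto simp: j_def)
    finally show ?thesis .
  qed (simp add: g_def)
  show "G x = (\<Sum>l\<le>q. g l * x ^ l)" if x: "x \<in> circle u" for x
  proof -
    have "(\<Sum>l\<le>q. g l * x ^ l) = (\<Sum>l\<le>q. \<Sum>t\<in>circle u. G t * (x * inverse t) ^ l)"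
      by (intro sum.cong refl) (simp add: g_def sum_distrib_left power_mult_distrib mult_ac)
    also have "\<dots> = (\<Sum>t\<in>circle u. G t * (\<Sum>l\<le>q. (x * inverse t) ^ l))"
      by (subst sum.swap) (simp add: sum_distrib_left)
    also have "\<dots> = (\<Sum>t\<in>circle u. if x = t then G t else 0)"
      using u x by (intro sum.cong refl) (simp add: geometric_circle)
    also have "\<dots> = G x"
      using x by simp
    finally show ?thesis ..
  qed
qed

text \<open>Once \<open>x ^ (q + 1) = u\<close> has lowered all degrees to at most \<open>q\<close>,
  the \<open>q + 1\<close> points of the circle allow comparison of coefficients. The term of
  \<open>g (q div 2 + 1)\<close> in the square is the only one to wrap around, landing at
  \<open>l = 1\<close>; the right-hand side is expanded by \<open>geometric_circle\<close>.\<close>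

lemma circle_coefficients:
  assumes u: "u \<noteq> 0" "u ^ q = u" and q: "q > 8"
    and g0: "\<And>l. q + 2 < 2 * l \<Longrightarrow> g l = 0"
    and eq: "\<And>x. x \<in> circle u \<Longrightarrow>
      (\<Sum>l\<le>q. g l * x ^ l) ^ 2 + (x + z) * (\<Sum>l\<le>q. g l * x ^ l) = (if x = z then \<kappa> else 0)"
    and l: "l \<le> q"
  shows "(if even l then g (l div 2) ^ 2 else 0) + (if l = 1 then u * g (q div 2 + 1) ^ 2 else 0)
    + (if l = 0 then 0 else g (l - 1)) + z * g l
    + (if z \<in> circle u then \<kappa> * inverse z ^ l else 0) = 0"
    (is "?c l = 0")
proof (rule coeffs_eq_0_of_many_zeros[where A = "circle u" and n = q])
  show "q < card (circle u)"
    using card_circle[OF u] by simp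
  fix x assume x: "x \<in> circle u"
  define p where "p = q div 2"
  have p: "q = 2 * p" using even_q by (simp add: p_def)
  define W where "W = (\<Sum>l\<le>q. g l * x ^ l)"
  have e1: "(\<Sum>l\<le>q. (if even l then g (l div 2) ^ 2 else 0) * x ^ l) + u * g (p + 1) ^ 2 * x =
      W ^ 2"
  proof -
    have "(\<Sum>l\<le>q. (if even l then g (l div 2) ^ 2 else 0) * x ^ l) =
        (\<Sum>l\<in>(\<lambda>l. 2 * l) ` {..p}. (if even l then g (l div 2) ^ 2 else 0) * x ^ l)"
      by (intro sum.mono_neutral_right) (auto simp: p elim!: evenE)
    also have "\<dots> = (\<Sum>l\<le>p. g l ^ 2 * x ^ (2 * l))"
      by (subst sum.reindex) (auto simp: inj_on_def)
    finally have 1: "(\<Sum>l\<le>q. (if even l then g (l div 2) ^ 2 else 0) * x ^ l) =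
        (\<Sum>l\<le>p. g l ^ 2 * x ^ (2 * l))" .
    have "W ^ 2 = (\<Sum>l\<le>q. g l ^ 2 * x ^ (2 * l))"
      unfolding W_def square_sum by (simp add: power_mult_distrib mult.commute flip: power_mult)
    also have "\<dots> = (\<Sum>l\<le>p + 1. g l ^ 2 * x ^ (2 * l))"
      using q p by (intro sum.mono_neutral_right) (auto simp: g0)
    also have "\<dots> = (\<Sum>l\<le>p. g l ^ 2 * x ^ (2 * l)) + g (p + 1) ^ 2 * (x ^ (q + 1) * x)"
      by (simp add: p mult_ac)
    finally show ?thesis
      using x 1 by (simp add: circle_def mult_ac)
  qed
  have e2: "(\<Sum>l\<le>q. (if l = 1 then u * g (p + 1) ^ 2 else 0) * x ^ l) = u * g (p + 1) ^ 2 * x"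
  proof -
    have "(\<Sum>l\<le>q. (if l = 1 then u * g (p + 1) ^ 2 else 0) * x ^ l) =
        (\<Sum>l\<le>q. if l = 1 then u * g (p + 1) ^ 2 * x else 0)"
      by (intro sum.cong) auto
    then show ?thesis using q by simp
  qed
  have e3: "(\<Sum>l\<le>q. (if l = 0 then 0 else g (l - 1)) * x ^ l) = x * W"
  proof -
    \<comment> \<open>The extra term at \<open>l = q + 1\<close> is 0 because
      \<open>g q = 0\<close>.\<close>
    have "(\<Sum>l\<le>q. (if l = 0 then 0 else g (l - 1)) * x ^ l) =
        (\<Sum>l\<le>Suc q. (if l = 0 then 0 else g (l - 1)) * x ^ l)"
      using q by (simp add: g0)
    also have "\<dots> = (\<Sum>l\<le>q. g l * x ^ Suc l)"
      unfolding sum.atMost_Suc_shift by simp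
    also have "\<dots> = x * W"
      by (simp add: W_def sum_distrib_left mult_ac)
    finally show ?thesis .
  qed
  have e4: "(\<Sum>l\<le>q. z * g l * x ^ l) = z * W"
    by (simp add: W_def sum_distrib_left mult_ac)
  have W: "W ^ 2 + (x + z) * W = (if x = z then \<kappa> else 0)"
    using eq[OF x] by (simp only: W_def)
  have e5: "(\<Sum>l\<le>q. (if z \<in> circle u then \<kappa> * inverse z ^ l else 0) * x ^ l) =
      W ^ 2 + (x + z) * W"
  proof (cases "z \<in> circle u")
    case True
    then have "(\<Sum>l\<le>q. (if z \<in> circle u then \<kappa> * inverse z ^ l else 0) * x ^ l) =
        \<kappa> * (\<Sum>l\<le>q. (x * inverse z) ^ l)"
      by (simp add: sum_distrib_left power_mult_distrib mult_ac)
    then show ?thesis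
      using geometric_circle[OF x True u(1)] W by simp
  qed (use x W in auto)
  show "(\<Sum>l\<le>q. ?c l * x ^ l) = 0"
    unfolding p_def[symmetric] distrib_right sum.distrib e2 e3 e4 e5 e1[symmetric]
    by (simp add: add_ac)
qed (fact l)

lemma circle_rigidity:
  fixes G :: "'a \<Rightarrow> 'a"
  assumes u: "u \<noteq> 0" "u ^ q = u" and q: "q > 8" and "\<kappa> \<noteq> 0"
    and mom: "\<And>j. 0 < j \<Longrightarrow> 2 * j < q \<Longrightarrow> (\<Sum>t\<in>circle u. t ^ j * G t) = 0"
    and eq: "\<And>x. x \<in> circle u \<Longrightarrow> G x ^ 2 + (x + z) * G x = (if x = z then \<kappa> else 0)"
  shows "z \<notin> circle u \<and> ((\<forall>x\<in>circle u. G x = 0) \<or> (\<forall>x\<in>circle u. G x = x + z))"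
proof -
  obtain g where g0: "\<And>l. q + 2 < 2 * l \<Longrightarrow> g l = 0"
    and g: "\<And>x. x \<in> circle u \<Longrightarrow> G x = (\<Sum>l\<le>q. g l * x ^ l)"
    using circle_interpolation[OF u(1) mom] by blast
  note coeff0 = circle_coefficients[OF u q g0, where \<kappa> = \<kappa> and z = z]
  have coeff: "(if even l then g (l div 2) ^ 2 else 0)
    + (if l = 1 then u * g (q div 2 + 1) ^ 2 else 0)
    + (if l = 0 then 0 else g (l - 1)) + z * g l
    + (if z \<in> circle u then \<kappa> * inverse z ^ l else 0) = 0" if "l \<le> q" for l
    using that eq g by (intro coeff0) auto
  have 4: "4 dvd q"
  proof -
    have "2 < h"
    proof (rule ccontr)
      assume "\<not> 2 < h"
      then have "q \<le> 2 ^ 2" unfolding q_def by (intro power_increasing) auto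
      with q show False by simp
    qed
    then have "(2::nat) ^ 2 dvd 2 ^ h" by (intro le_imp_power_dvd) auto
    then show ?thesis by (simp add: q_def)
  qed
  then obtain p where p: "q = 2 * p" "even p" by auto
  \<comment> \<open>At the odd index \<open>q - 1\<close> every other contribution vanishes, leaving
    a nonzero multiple of \<open>\<kappa>\<close>.\<close>
  have z: "z \<notin> circle u"
  proof
    assume "z \<in> circle u"
    moreover from this have "z \<noteq> 0" using u by (auto simp: circle_def)
    moreover have "g (q - 2) = 0" "g (q - 1) = 0"
      using q by (intro g0; simp)+
    moreover have "odd (q - 1)" "q - 1 \<noteq> 1" "q - 1 \<noteq> 0" "q - 1 - 1 = q - 2" "q - 1 \<le> q"
      using q even_q by auto
    ultimately show False
      using coeff[of "q - 1"] \<open>\<kappa> \<noteq> 0\<close> by (auto simp del: One_nat_def split: if_splits)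
  qed
  have "g p = 0"
    using coeff[of q] even_q q z g0[of "q - 1"] g0[of q] p by simp
  \<comment> \<open>As \<open>p\<close> is even, the index \<open>p + 1\<close> is odd and receives
    no square.\<close>
  then have zT: "z * g (p + 1) = 0"
    using coeff[of "p + 1"] p q z by simp
  have T: "g (p + 1) = 0"
  proof (cases "z = 0")
    case True
    then show ?thesis
      using coeff[of 0] coeff[of 1] p q z u by simp
  qed (use zT in simp)
  have high: "g l = 0" if "2 \<le> l" for l
    using that
  \<comment> \<open>Downward induction: coefficient \<open>2 * l\<close> expresses
    \<open>g l ^ 2\<close> through \<open>g (2 * l - 1)\<close> and \<open>g (2 * l)\<close>, both
    of larger index.\<close>
  proof (induction "2 * q - l" arbitrary: l rule: less_induct)
    case (less l)
    consider "l \<le> p" | "l = p + 1" | "l > p + 1" by linarith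
    then show ?case
    proof cases
      case 1
      have "g (2 * l - 1) = 0" "g (2 * l) = 0"
        using 1 less p by (auto intro!: less.hyps)
      then show ?thesis
        using coeff[of "2 * l"] 1 p z by (auto split: if_splits)
    qed (use T g0 p in auto)
  qed
  have "g 1 ^ 2 + g 1 = 0"
    using coeff[of 2] q z high[of 2] by simp
  then have "g 1 * (g 1 + 1) = 0"
    by (simp add: distrib_left power2_eq_square)
  then have g1: "g 1 = 0 \<or> g 1 = 1"
    by (auto simp: add_eq_0_iff_eq)
  have "g 0 = z * g 1"
    using coeff[of 1] z T p q by (simp add: add_eq_0_iff_eq)
  moreover have "G x = g 0 + g 1 * x" if "x \<in> circle u" for x
  proof -
    have "G x = (\<Sum>l\<in>{0, 1}. g l * x ^ l)"
      unfolding g[OF that] using q by (intro sum.mono_neutral_right) (auto simp: high)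
    then show ?thesis by simp
  qed
  ultimately show ?thesis
    using z g1 by (auto simp: add_ac)
qed

subsection \<open>The Artin-Schreier map\<close>

abbreviation artin_schreier :: "'a \<Rightarrow> 'a" where
  "artin_schreier z \<equiv> z ^ 2 + z"

lemma artin_schreier_add: "artin_schreier (y + z) = artin_schreier y + artin_schreier z"
  by (simp add: square_add add_ac)

lemma artin_schreier_eq_iff: "artin_schreier y = artin_schreier z \<longleftrightarrow> y = z \<or> y = z + 1"
proof -
  have "artin_schreier y = artin_schreier z \<longleftrightarrow> artin_schreier (y + z) = 0"
    unfolding artin_schreier_add add_eq_0_iff_eq ..
  also have "artin_schreier (y + z) = (y + z) * (y + z + 1)"
    by (simp add: power2_eq_square distrib_left)
  also have "\<dots> = 0 \<longleftrightarrow> y = z \<or> y = z + 1"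
    by (simp add: add_eq_0_iff_eq add.assoc)
  finally show ?thesis .
qed

lemma card_artin_schreier_image:
  assumes "\<And>z. z \<in> K \<Longrightarrow> z + 1 \<in> K"
  shows "card K = 2 * card (artin_schreier ` K)"
proof (rule card_eq_mult_fibres)
  fix v assume "v \<in> artin_schreier ` K"
  then obtain z where z: "z \<in> K" "v = artin_schreier z" by auto
  then have "{x \<in> K. artin_schreier x = v} = {z, z + 1}"
    using assms by (auto simp: artin_schreier_eq_iff)
  then show "card {x \<in> K. artin_schreier x = v} = 2" by simp
qed simp

text \<open>The image contains half of the field, so its translate by an outside element
  \<open>e\<close> is the other half.\<close>

lemma artin_schreier_index_2:
  assumes "e \<notin> range artin_schreier"
  shows "v \<in> range artin_schreier \<or> v + e \<in> range artin_schreier"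
proof -
  let ?H = "range artin_schreier" and ?H' = "(+) e ` range artin_schreier"
  have "?H \<inter> ?H' = {}"
  proof (rule ccontr)
    assume "?H \<inter> ?H' \<noteq> {}"
    then obtain y z where "artin_schreier y = e + artin_schreier z" by blast
    then have "e = artin_schreier (y + z)"
      unfolding artin_schreier_add by (simp add: add_ac)
    with assms show False by blast
  qed
  then have "card (?H \<union> ?H') = card (UNIV :: 'a set)"
    using card_artin_schreier_image[of UNIV] by (simp add: card_Un_disjoint card_image)
  then have "?H \<union> ?H' = UNIV"
    by (intro card_subset_eq) auto
  then have "v \<in> ?H \<union> ?H'" by blast
  then show ?thesis
    by (auto simp: add.commute[of e] add.assoc)
qed

lemma card_artin_schreier_subfield: "2 * card (artin_schreier ` {r. r ^ q = r}) \<le> q"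
proof -
  have "{r::'a. r ^ q = r} \<subseteq> insert 0 {r. r ^ (q - 1) = 1}"
  proof
    fix r :: 'a assume "r \<in> {r. r ^ q = r}"
    moreover have "r * r ^ (q - 1) = r ^ q"
      using q_ge_2 by (simp flip: power_Suc)
    ultimately show "r \<in> insert 0 {r. r ^ (q - 1) = 1}" by auto
  qed
  then have "card {r::'a. r ^ q = r} \<le> card (insert 0 {r::'a. r ^ (q - 1) = 1})"
    by (intro card_mono) auto
  also have "\<dots> \<le> Suc (card {r::'a. r ^ (q - 1) = 1})"
    by (rule card_insert_le_m1) auto
  also have "\<dots> \<le> q"
    using card_power_eq_le[of "q - 1" 1] q_ge_2 by simp
  finally show ?thesis
    by (subst card_artin_schreier_image[symmetric]) (simp_all add: frob_add)
qed

text \<open>The relative trace \<open>z + z ^ q\<close> lies in GF(q) and commutes with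
  \<open>artin_schreier\<close>.\<close>

lemma artin_schreier_rel_trace:
  assumes "v \<in> range artin_schreier"
  shows "v + v ^ q \<in> artin_schreier ` {r. r ^ q = r}"
proof -
  obtain z where z: "v = artin_schreier z" using assms by blast
  have "(z + z ^ q) ^ q = z + z ^ q"
    by (simp add: frob_add add_ac)
  moreover have "v + v ^ q = artin_schreier (z + z ^ q)"
    unfolding z artin_schreier_add frob_add by (simp add: add_ac mult.commute flip: power_mult)
  ultimately show ?thesis by blast
qed

text \<open>The relative trace of \<open>e + d / (x + z)\<^sup>2\<close> is at most two-to-one on the circle, so its
  \<open>q + 1\<close> values cannot all lie in the image of \<open>GF(q)\<close> under
  \<open>artin_schreier\<close>, which has \<open>q / 2\<close> elements.\<close>
lemma not_all_in_artin_schreier: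
  assumes u: "u \<noteq> 0" "u ^ q = u" and z: "z \<notin> circle u" and d: "d \<noteq> 0"
    and all: "\<And>x. x \<in> circle u \<Longrightarrow> e + d / (x + z) ^ 2 \<in> range artin_schreier"
  shows False
proof -
  define f where "f x = (e + d / (x + z) ^ 2) + (e + d / (x + z) ^ 2) ^ q" for x
  have "card (circle u) \<le> 2 * card (artin_schreier ` {r. r ^ q = r})"
  proof (rule card_le_mult_fibres)
    show "f ` circle u \<subseteq> artin_schreier ` {r. r ^ q = r}"
      using artin_schreier_rel_trace[OF all] by (auto simp: f_def)
    fix \<kappa>
    define s s' d' k where "s = z ^ 2" and "s' = s ^ q" and "d' = d ^ q" and "k = \<kappa> + (e + e ^ q)"
    \<comment> \<open>The equation \<open>f x = \<kappa>\<close> in \<open>T = x ^ 2\<close>, with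
      denominators cleared by means of \<open>T * T ^ q = u ^ 2\<close>.\<close>
    define P where "P = [:d * u ^ 2 + k * s * u ^ 2, d * s' + d' * s + k * (u ^ 2 + s * s'), d' + k * s':]"
    have polyP: "poly P T = d * (u ^ 2 + s' * T) + d' * T * (T + s) + k * ((T + s) * (u ^ 2 + s' * T))"
      for T
      by (simp add: P_def algebra_simps)
    \<comment> \<open>\<open>P\<close> is nonzero because its value at \<open>s\<close> is:
      \<open>z\<close> has a norm other than \<open>u\<close>.\<close>
    have "u \<noteq> z * z ^ q"
      using z by (simp add: circle_def eq_commute)
    then have "u ^ 2 \<noteq> s * s'"
      using square_inject[of u "z * z ^ q"]
      by (simp add: s_def s'_def power_mult_distrib mult.commute flip: power_mult)
    moreover have "poly P s = d * (u ^ 2 + s * s')"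
      by (simp add: polyP mult.commute)
    ultimately have "poly P s \<noteq> 0"
      using d by (simp add: add_eq_0_iff_eq)
    then have P: "P \<noteq> 0" by auto
    have root: "poly P (x ^ 2) = 0" if x: "x \<in> circle u" "f x = \<kappa>" for x
    proof -
      define T where "T = x ^ 2"
      have x0: "x \<noteq> 0" using x u by (auto simp: circle_def)
      have "x + z \<noteq> 0" using x z by (auto simp: add_eq_0_iff_eq)
      then have Ts: "T + s \<noteq> 0" by (simp add: T_def s_def flip: square_add)
      have "T * T ^ q = u ^ 2"
        using x by (auto simp: T_def circle_def power_mult_distrib mult.commute[of _ q]
          simp flip: power_mult)
      then have Tq: "T * (T + s) ^ q = u ^ 2 + s' * T"
        by (simp add: frob_add s'_def distrib_left mult.commute)
      have Tsq: "(T + s) ^ q \<noteq> 0" using Ts by simp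
      have T0: "T \<noteq> 0" using x0 by (simp add: T_def)
      have "f x = (e + d / (T + s)) + (e ^ q + d' / (T + s) ^ q)"
        by (simp add: f_def square_add T_def s_def d'_def frob_add power_divide)
      then have k: "k = d / (T + s) + d' / (T + s) ^ q"
        using x by (simp add: k_def add_ac)
      have "k * ((T + s) * (T * (T + s) ^ q)) = d * (T * (T + s) ^ q) + d' * T * (T + s)"
      proof -
        have "(d / A + d' / B) * (A * (T * B)) = d * (T * B) + d' * T * A"
          if "A \<noteq> 0" "B \<noteq> 0" for A B
          using that by (simp add: field_simps)
        from this[OF Ts Tsq] show ?thesis
          unfolding k .
      qed
      then show ?thesis
        by (simp add: polyP Tq flip: T_def)
    qed
    have "card {x \<in> circle u. f x = \<kappa>} = card ((\<lambda>x. x ^ 2) ` {x \<in> circle u. f x = \<kappa>})"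
      by (intro card_image[symmetric]) (auto simp: inj_on_def square_inject)
    also have "\<dots> \<le> card {T. poly P T = 0}"
      using root by (intro card_mono) auto
    also have "\<dots> \<le> degree P"
      using P by (rule card_poly_roots_bound)
    also have "\<dots> \<le> 2"
      by (simp add: P_def)
    finally show "card {x \<in> circle u. f x = \<kappa>} \<le> 2" .
  qed auto
  then show False
    using card_artin_schreier_subfield card_circle[OF u] by simp
qed

end

subsection \<open>Vertical lines\<close>

context ellipse
begin

definition fibre :: "'a \<Rightarrow> 'a set" where
  "fibre x = {y. (x, y) \<in> hyperoval}"

text \<open>Multiplying the equation by \<open>b / X ^ 2\<close> turns it into an Artin-Schreier
  equation in \<open>b * Y / X\<close>.\<close>

lemma fibre_nonempty_iff:
  assumes "x \<noteq> x0"
  shows "fibre x \<noteq> {} \<longleftrightarrow> a * b + b * c / (x + x0) ^ 2 \<in> range artin_schreier"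
proof -
  define X where "X = x + x0"
  have X: "X \<noteq> 0" using assms by (simp add: X_def add_eq_0_iff_eq)
  have key: "a * X ^ 2 + X * Y + b * Y ^ 2 = c \<longleftrightarrow>
      a * b + b * c / X ^ 2 = artin_schreier (b * Y / X)" for Y
  proof -
    have "a * X ^ 2 + X * Y + b * Y ^ 2 = c \<longleftrightarrow>
        b / X ^ 2 * (a * X ^ 2 + X * Y + b * Y ^ 2) = b / X ^ 2 * c"
      using X b_nz by simp
    also have "b / X ^ 2 * (a * X ^ 2 + X * Y + b * Y ^ 2) = a * b + artin_schreier (b * Y / X)"
      using X by (simp add: field_simps power2_eq_square)
    also have "a * b + artin_schreier (b * Y / X) = b / X ^ 2 * c \<longleftrightarrow>
        a * b + b * c / X ^ 2 = artin_schreier (b * Y / X)"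
      by (auto simp: add.assoc dest: sym)
    finally show ?thesis .
  qed
  show ?thesis
  proof
    assume "fibre x \<noteq> {}"
    then show "a * b + b * c / (x + x0) ^ 2 \<in> range artin_schreier"
      using key assms by (auto simp: fibre_def hyperoval_def simp flip: X_def)
  next
    assume "a * b + b * c / (x + x0) ^ 2 \<in> range artin_schreier"
    then obtain z where "a * b + b * c / X ^ 2 = artin_schreier z" by (auto simp: X_def)
    then have "a * X ^ 2 + X * (X * z / b) + b * (X * z / b) ^ 2 = c"
      unfolding key using X b_nz by simp
    then have "X * z / b + y0 \<in> fibre x"
      by (simp add: fibre_def hyperoval_def X_def add.assoc)
    then show "fibre x \<noteq> {}" by blast
  qed
qed

text \<open>Two solutions on a vertical line differ by \<open>(x + x0) / b\<close>, which is also
  their sum.\<close>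

lemma fibre_sum:
  assumes "x \<noteq> x0"
  shows "b * \<Sum>(fibre x) = (if fibre x = {} then 0 else x + x0)"
proof (cases "fibre x = {}")
  case False
  then obtain y where y: "y \<in> fibre x" by blast
  define X where "X = x + x0"
  have X: "X \<noteq> 0" using assms by (simp add: X_def add_eq_0_iff_eq)
  define E where "E Y = a * X ^ 2 + X * Y + b * Y ^ 2" for Y
  have mem: "y' \<in> fibre x \<longleftrightarrow> E (y' + y0) = c" for y'
    using assms by (simp add: fibre_def hyperoval_def E_def X_def)
  have E_add: "E (Y + d) = E Y + d * (X + b * d)" for Y d
    by (simp add: E_def square_add ring_distribs power2_eq_square[of d] mult_ac add_ac)
  have "y' \<in> fibre x \<longleftrightarrow> y' = y \<or> y' = y + X / b" for y'
  proof -
    have "y' \<in> fibre x \<longleftrightarrow> E ((y + y0) + (y + y')) = c"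
      unfolding mem by (simp add: add_ac)
    also have "\<dots> \<longleftrightarrow> (y + y') * (X + b * (y + y')) = 0"
      using y unfolding E_add mem by simp
    also have "\<dots> \<longleftrightarrow> y' = y \<or> X = b * (y + y')"
      by (auto simp: add_eq_0_iff_eq)
    also have "X = b * (y + y') \<longleftrightarrow> X / b = y + y'"
      using b_nz by (auto simp: field_simps)
    also have "\<dots> \<longleftrightarrow> y' = y + X / b" by auto
    finally show ?thesis .
  qed
  then have "fibre x = {y, y + X / b}" by blast
  moreover have "X / b \<noteq> 0" using X b_nz by simp
  ultimately show ?thesis
    using False b_nz by (simp add: X_def)
qed simp

lemma fibre_sum_x0: "(b * \<Sum>(fibre x0)) ^ 2 = b * c"
proof -
  define r where "r = root2 (c / b)"
  have r: "r ^ 2 = c / b" by (simp add: r_def)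
  then have "r \<noteq> 0" using b_nz c_nz by auto
  have "y \<in> fibre x0 \<longleftrightarrow> y = y0 \<or> y = y0 + r" for y
  proof -
    have "b * (y + y0) ^ 2 = c \<longleftrightarrow> (y + y0) ^ 2 = r ^ 2"
      unfolding r using b_nz by (auto simp: field_simps)
    also have "\<dots> \<longleftrightarrow> y + y0 = r" by (rule square_inject)
    also have "\<dots> \<longleftrightarrow> y = y0 + r" by (auto simp: add_ac)
    finally show ?thesis by (auto simp: fibre_def hyperoval_def)
  qed
  then have "fibre x0 = {y0, y0 + r}" by blast
  with \<open>r \<noteq> 0\<close> have "\<Sum>(fibre x0) = r" by simp
  then show ?thesis
    using r b_nz by (simp add: power_mult_distrib) (simp add: power2_eq_square)
qed

text \<open>A preimage \<open>z\<close> would make \<open>z / b\<close> a root excluded by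
  \<open>no_root\<close>.\<close>

lemma ab_notin_artin_schreier: "a * b \<notin> range artin_schreier"
proof
  assume "a * b \<in> range artin_schreier"
  then obtain z where z: "a * b = artin_schreier z" by blast
  have "b * (a + z / b + b * (z / b) ^ 2) = a * b + artin_schreier z"
    using b_nz by (simp add: field_simps power2_eq_square)
  then show False
    using z no_root[of "z / b"] b_nz by simp
qed

lemma hyperoval_not_arc:
  assumes U: "U \<noteq> {}" "U \<subseteq> {x. x \<noteq> 0 \<and> x ^ q = x}" "4 * card U \<le> q" and q: "q > 8"
  shows "\<not> is_arc_closure_M q U ((\<lambda>(x, y). Aff x y) ` hyperoval)"
proof
  assume arc: "is_arc_closure_M q U ((\<lambda>(x, y). Aff x y) ` hyperoval)"
  obtain u where u: "u \<in> U" "u \<noteq> 0" "u ^ q = u" using U by blast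
  let ?A = "{(x, y). (x, y) \<in> hyperoval \<and> x ^ (q + 1) \<in> U}"
  define G where "G x = b * \<Sum>(fibre x)" for x
  have "(\<Sum>t\<in>circle u. t ^ j * G t) = 0" if j: "0 < j" "2 * j < q" for j
  proof -
    have "(\<Sum>t\<in>circle u. t ^ j * G t) = b * (\<Sum>t\<in>circle u. \<Sum>y\<in>fibre t. t ^ j * y)"
      by (simp add: G_def sum_distrib_left mult_ac)
    also have "(\<Sum>t\<in>circle u. \<Sum>y\<in>fibre t. t ^ j * y) =
        (\<Sum>(x, y)\<in>Sigma (circle u) fibre. x ^ j * y)"
      by (rule sum.Sigma) auto
    also have "Sigma (circle u) fibre = {(x, y). (x, y) \<in> ?A \<and> x ^ (q + 1) = u}"
      using u by (auto simp: circle_def fibre_def)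
    also have "(\<Sum>(x, y)\<in>\<dots>. x ^ j * y) = 0"
      by (rule circle_moment_eq_0[of ?A U]) (use sum_affected_conj[OF arc] u U j in auto)
    finally show ?thesis by simp
  qed
  moreover have "G x ^ 2 + (x + x0) * G x = (if x = x0 then b * c else 0)" for x
    using fibre_sum[of x] fibre_sum_x0 by (auto simp: G_def power2_eq_square)
  ultimately have x0: "x0 \<notin> circle u"
    and "(\<forall>x\<in>circle u. G x = 0) \<or> (\<forall>x\<in>circle u. G x = x + x0)"
    using circle_rigidity[OF u(2,3) q, of "b * c" G x0] b_nz c_nz by auto
  then consider "\<forall>x\<in>circle u. fibre x = {}" | "\<forall>x\<in>circle u. fibre x \<noteq> {}"
    using fibre_sum unfolding G_def by (metis add_eq_0_iff_eq)
  then show False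
  proof cases
    case 1
    \<comment> \<open>Both \<open>a * b\<close> and the sum with \<open>b * c / (x + x0) ^ 2\<close>
      lie outside the image, which has index 2; so their difference lies inside.\<close>
    have "0 + b * c / (x + x0) ^ 2 \<in> range artin_schreier" if x: "x \<in> circle u" for x
    proof -
      have "x \<noteq> x0" using x x0 by auto
      then have "a * b + b * c / (x + x0) ^ 2 \<notin> range artin_schreier"
        using 1 x fibre_nonempty_iff by blast
      with artin_schreier_index_2[OF ab_notin_artin_schreier, of "a * b + b * c / (x + x0) ^ 2"] show ?thesis
        by (auto simp: add_ac)
    qed
    then show False
      using not_all_in_artin_schreier[OF u(2,3) x0, of "b * c" 0] b_nz c_nz by auto
  next
    case 2
    have "a * b + b * c / (x + x0) ^ 2 \<in> range artin_schreier" if "x \<in> circle u" for x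
      using that 2 x0 fibre_nonempty_iff[of x] by auto
    then show False
      using not_all_in_artin_schreier[OF u(2,3) x0, of "b * c" "a * b"] b_nz c_nz by auto
  qed
qed

end

subsection \<open>Equation of a regular hyperoval\<close>

lemma ppt_eqD: "ppt v = ppt w \<Longrightarrow> \<exists>k. k \<noteq> 0 \<and> v = scal3 k w"
proof -
  assume "ppt v = ppt w"
  moreover have "v \<in> ppt v"
    by (auto simp: ppt_def scal3_def split: prod.splits intro!: exI[of _ 1])
  ultimately show ?thesis by (auto simp: ppt_def)
qed

lemma ppt_affine_inject: "ppt (x, y, 1) = ppt (x', y', 1) \<longleftrightarrow> x = x' \<and> y = y'"
  by (auto dest!: ppt_eqD simp: scal3_def)

lemma ppt_infinite_neq_affine: "ppt (x, y, 0) \<noteq> ppt (x', y', 1)"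
  by (auto dest!: ppt_eqD simp: scal3_def)

lemma ppt_affine_in_line:
  "ppt (x, y, 1) \<in> proj_line (l, m, n) \<longleftrightarrow> l * x + m * y + n = 0"
proof
  assume "ppt (x, y, 1) \<in> proj_line (l, m, n)"
  then obtain x' y' z' where v: "ppt (x, y, 1) = ppt (x', y', z')" "l * x' + m * y' + n * z' = 0"
    by (auto simp: proj_line_def)
  from ppt_eqD[OF v(1)] obtain k where "k \<noteq> 0" "x = k * x'" "y = k * y'" "1 = k * z'"
    by (auto simp: scal3_def)
  then have "l * x + m * y + n = k * (l * x' + m * y' + n * z')"
    by (simp add: algebra_simps)
  then show "l * x + m * y + n = 0" using v by simp
next
  assume "l * x + m * y + n = 0"
  then have "\<exists>x' y' z'. ppt (x, y, 1) = ppt (x', y', z') \<and> (x', y', z') \<noteq> (0, 0, 0) \<and>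
      l * x' + m * y' + n * z' = 0"
    by (intro exI[of _ x] exI[of _ y] exI[of _ 1]) simp
  then show "ppt (x, y, 1) \<in> proj_line (l, m, n)"
    unfolding proj_line_def by simp
qed

lemma qform_scal3: "qform a b c d e f (scal3 k v) = k ^ 2 * qform a b c d e f v"
  by (simp add: qform_def scal3_def algebra_simps power2_eq_square split: prod.splits)

lemma ppt_in_conic_of_qform:
  assumes "v \<noteq> (0, 0, 0)"
  shows "ppt v \<in> conic_of (qform a b c d e f) \<longleftrightarrow> qform a b c d e f v = 0"
proof
  assume "ppt v \<in> conic_of (qform a b c d e f)"
  then obtain w where "ppt v = ppt w" "qform a b c d e f w = 0"
    by (auto simp: conic_of_def)
  then show "qform a b c d e f v = 0"
    using ppt_eqD[of v w] by (auto simp: qform_scal3)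
next
  assume "qform a b c d e f v = 0"
  then show "ppt v \<in> conic_of (qform a b c d e f)"
    using assms unfolding conic_of_def by blast
qed

context GFq2
begin

text \<open>The absence of points at infinity makes \<open>a\<close>, \<open>b\<close> and
  \<open>d\<close> nonzero. Two tangents place the nucleus at \<open>(f / d, e / d)\<close>;
  translating it to the origin removes the linear terms, and division by \<open>d\<close> normalises
  the equation.\<close>

lemma regular_hyperoval_AG_equation:
  fixes \<Omega> :: "('a \<times> 'a) set"
  assumes "regular_hyperoval_AG \<Omega>"
  obtains a b c x0 y0 where "b \<noteq> 0" "c \<noteq> 0" "\<And>m. a + m + b * m ^ 2 \<noteq> 0"
    "\<Omega> = {(x, y). a * (x + x0) ^ 2 + (x + x0) * (y + y0) + b * (y + y0) ^ 2 = c \<or>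
       (x = x0 \<and> y = y0)}"
proof -
  obtain C N where C: "nondeg_conic C" and N: "is_nucleus C N" and \<Omega>: "aff_pt ` \<Omega> = C \<union> {N}"
    using assms by (auto simp: regular_hyperoval_AG_def regular_hyperoval_PG_def)
  obtain a b c d e f where nd: "nondeg_qf (qform a b c d e f)" and
    C_def: "C = conic_of (qform a b c d e f)"
    using C by (auto simp: nondeg_conic_def)
  define Q where "Q x y z = a * x ^ 2 + b * y ^ 2 + c * z ^ 2 + d * x * y + e * x * z + f * y * z"
    for x y z
  have Q: "qform a b c d e f (x, y, z) = Q x y z" for x y z
    by (simp add: qform_def Q_def)
  have inC: "ppt (x, y, 1) \<in> C \<longleftrightarrow> Q x y 1 = 0" for x y
    unfolding C_def Q[symmetric] by (intro ppt_in_conic_of_qform) simp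
  have affine: "\<exists>x y. P = ppt (x, y, 1)" if "P \<in> C \<union> {N}" for P
    using that unfolding \<Omega>[symmetric] by (auto simp: aff_pt_def)
  have at_infinity: "Q x y 0 \<noteq> 0" if "(x, y) \<noteq> (0, 0)" for x y
  proof
    assume "Q x y 0 = 0"
    then have "ppt (x, y, 0) \<in> C"
      unfolding C_def Q[symmetric] using that by (subst ppt_in_conic_of_qform) auto
    with affine[of "ppt (x, y, 0)"] show False
      using ppt_infinite_neq_affine by fastforce
  qed
  have a: "a \<noteq> 0" and b: "b \<noteq> 0"
    using at_infinity[of 1 0] at_infinity[of 0 1] by (simp_all add: Q_def)
  have d: "d \<noteq> 0"
  proof
    assume "d = 0"
    \<comment> \<open>Without mixed term, \<open>a * x ^ 2 + b * y ^ 2\<close> vanishes at the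
      square roots of \<open>b\<close> and \<open>a\<close>.\<close>
    moreover have "root2 b \<noteq> 0" using root2_square[of b] b by fastforce
    ultimately show False
      using at_infinity[of "root2 b" "root2 a"] by (simp add: Q_def mult.commute)
  qed
  have tangent: "N \<in> proj_line (l, m, n)"
    if "(l, m, n) \<noteq> (0, 0, 0)" "\<And>x y. l * x + m * y + n = 0 \<and> Q x y 1 = 0 \<longleftrightarrow> x = x1 \<and> y = y1"
    for l m n x1 y1
  proof -
    have "proj_line (l, m, n) \<inter> C = {ppt (x1, y1, 1)}"
    proof (intro equalityI subsetI)
      fix P assume P: "P \<in> proj_line (l, m, n) \<inter> C"
      then obtain x y where "P = ppt (x, y, 1)" using affine by blast
      with P that(2)[of x y] show "P \<in> {ppt (x1, y1, 1)}"
        by (simp add: inC ppt_affine_in_line)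
    qed (use that(2)[of x1 y1] in \<open>auto simp: inC ppt_affine_in_line\<close>)
    moreover have "proj_line (l, m, n) \<in> proj_lines"
      using that(1) by (auto simp: proj_lines_def)
    ultimately show ?thesis
      using N by (simp add: is_nucleus_def)
  qed
  obtain x0 y0 where N_eq: "N = ppt (x0, y0, 1)" using affine[of N] by blast
  have square_eq: "s * x ^ 2 + t = 0 \<longleftrightarrow> x = root2 (t / s)" if "s \<noteq> 0" for s t x :: 'a
  proof -
    have "s * x ^ 2 + t = 0 \<longleftrightarrow> x ^ 2 = t / s"
      using that by (auto simp: add_eq_0_iff_eq field_simps)
    also have "\<dots> \<longleftrightarrow> x = root2 (t / s)"
      using square_inject[of x "root2 (t / s)"] by simp
    finally show ?thesis .
  qed
  have e: "e = d * y0"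
  proof -
    \<comment> \<open>On the line \<open>y = e / d\<close> the terms linear in \<open>x\<close>
      cancel, so it meets the conic in a single point and must contain \<open>N\<close>.\<close>
    let ?t = "b * (e / d) ^ 2 + c + f * (e / d)"
    have "Q x (e / d) 1 = a * x ^ 2 + ?t" for x
      using d by (simp add: Q_def field_simps)
    moreover have "0 * x + d * y + e = 0 \<longleftrightarrow> y = e / d" for x y
      using d by (auto simp: add_eq_0_iff_eq field_simps)
    ultimately have "0 * x + d * y + e = 0 \<and> Q x y 1 = 0 \<longleftrightarrow> x = root2 (?t / a) \<and> y = e / d" for x y
      using square_eq[OF a, where x = x and t = ?t] by auto
    then have "N \<in> proj_line (0, d, e)"
      using d by (intro tangent[where ?x1.0 = "root2 (?t / a)" and ?y1.0 = "e / d"]) auto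
    then show ?thesis
      unfolding N_eq ppt_affine_in_line by (simp add: add_eq_0_iff_eq)
  qed
  have f: "f = d * x0"
  proof -
    let ?t = "a * (f / d) ^ 2 + c + e * (f / d)"
    have "Q (f / d) y 1 = b * y ^ 2 + ?t" for y
      using d by (simp add: Q_def field_simps)
    moreover have "d * x + 0 * y + f = 0 \<longleftrightarrow> x = f / d" for x y
      using d by (auto simp: add_eq_0_iff_eq field_simps)
    ultimately have "d * x + 0 * y + f = 0 \<and> Q x y 1 = 0 \<longleftrightarrow> x = f / d \<and> y = root2 (?t / b)" for x y
      using square_eq[OF b, where x = y and t = ?t] by auto
    then have "N \<in> proj_line (d, 0, f)"
      using d by (intro tangent[where ?x1.0 = "f / d" and ?y1.0 = "root2 (?t / b)"]) auto
    then show ?thesis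
      unfolding N_eq ppt_affine_in_line by (simp add: add_eq_0_iff_eq)
  qed
  have Q_nz: "Q x0 y0 1 \<noteq> 0"
  proof
    assume "Q x0 y0 1 = 0"
    \<comment> \<open>The nucleus spans the radical of the polar form, so a zero of \<open>Q\<close>
      there would be singular.\<close>
    moreover have "polar (qform a b c d e f) (x0, y0, 1) w = 0" for w
    proof (cases w)
      case (fields x y z)
      show ?thesis
        unfolding fields polar_def add3_def
        by (simp add: qform_def square_add ring_distribs e f)
          (simp add: mult_ac add_ac numeral_Bit0_eq_0)
    qed
    ultimately show False
      using nd unfolding nondeg_qf_def by (metis Q prod.inject zero_neq_one)
  qed
  have Q_eq: "Q x y 1 = 0 \<longleftrightarrow>
      a / d * (x + x0) ^ 2 + (x + x0) * (y + y0) + b / d * (y + y0) ^ 2 = Q x0 y0 1 / d" for x y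
  proof -
    have "Q x y 1 + Q x0 y0 1 = a * (x + x0) ^ 2 + d * ((x + x0) * (y + y0)) + b * (y + y0) ^ 2"
      by (simp add: Q_def square_add ring_distribs e f)
        (simp add: mult_ac add_ac numeral_Bit0_eq_0)
    then have "Q x y 1 = 0 \<longleftrightarrow>
        a * (x + x0) ^ 2 + d * ((x + x0) * (y + y0)) + b * (y + y0) ^ 2 = Q x0 y0 1"
      by (metis add_0_left add_eq_0_iff_eq add.assoc add_self)
    then show ?thesis
      using d by (simp add: field_simps)
  qed
  show ?thesis
  proof (rule that)
    show "b / d \<noteq> 0" "Q x0 y0 1 / d \<noteq> 0" using b d Q_nz by auto
    show "a / d + m + b / d * m ^ 2 \<noteq> 0" for m
    proof -
      have "d * (a / d + m + b / d * m ^ 2) = Q 1 m 0"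
        using d by (simp add: Q_def distrib_left add_ac)
      then show ?thesis using at_infinity[of 1 m] by auto
    qed
    have "(x, y) \<in> \<Omega> \<longleftrightarrow> Q x y 1 = 0 \<or> (x = x0 \<and> y = y0)" for x y
    proof -
      have "(x, y) \<in> \<Omega> \<longleftrightarrow> aff_pt (x, y) \<in> aff_pt ` \<Omega>"
        by (auto simp: aff_pt_def ppt_affine_inject)
      then show ?thesis
        unfolding \<Omega> by (auto simp: aff_pt_def inC N_eq ppt_affine_inject)
    qed
    then show "\<Omega> = {(x, y). a / d * (x + x0) ^ 2 + (x + x0) * (y + y0) + b / d * (y + y0) ^ 2
        = Q x0 y0 1 / d \<or> (x = x0 \<and> y = y0)}"
      unfolding Q_eq[symmetric] by auto
  qed
qed

end

theorem theorem1p2: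
  fixes h :: nat and U :: "'a::{field, finite} set" and \<Omega> :: "('a \<times> 'a) set"
  assumes "h > 1"
    and "card (UNIV :: 'a set) = (2 ^ h) ^ 2"
    and "U \<noteq> {}"
    and "U \<subseteq> {x. x \<noteq> 0 \<and> x ^ (2 ^ h) = x}"
    and "4 * (card U + 1) < 2 ^ h"
    and "regular_hyperoval_AG \<Omega>"
  shows "\<not> is_arc_closure_M (2 ^ h) U ((\<lambda>(x, y). Aff x y) ` \<Omega>)"
proof -
  interpret GFq2 h "2 ^ h" "TYPE('a)"
    by standard (use assms in auto)
  show ?thesis
  proof (rule regular_hyperoval_AG_equation[OF assms(6)])
    fix a b c x0 y0 :: 'a
    assume "b \<noteq> 0" "c \<noteq> 0" "\<And>m. a + m + b * m ^ 2 \<noteq> 0"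
    then interpret ellipse h "2 ^ h" "TYPE('a)" a b c x0 y0
      by unfold_locales auto
    assume "\<Omega> = {(x, y). a * (x + x0) ^ 2 + (x + x0) * (y + y0) + b * (y + y0) ^ 2 = c \<or>
      (x = x0 \<and> y = y0)}"
    then have "\<Omega> = hyperoval"
      by (simp only: hyperoval_def)
    \<comment> \<open>With \<open>card U\<close> at least 1, the size bound also yields
      \<open>8 < 2 ^ h\<close>.\<close>
    moreover have "card U > 0"
      using assms(3) by (simp add: card_gt_0_iff)
    ultimately show ?thesis
      using assms(3-5) hyperoval_not_arc[of U] by auto
  qed
qed

end
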